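(* Let $\mathbb{D}_Q\subset\mathbb{M}^d$ be an NC matrix unit ball, where $Q(X)=\sum_{j=1}^dQ_j\otimes X_j$ with $Q_1,\dots,Q_d\in M_{s\times r}$ linearly independent. Let $f\in\mathcal{SA}(\mathbb{D}_Q)$ be a non-constant NC function admitting a unitary realization $$f(X)=A^{(n)}+B^{(n)}\bigl[I-(Q(X)\otimes I_{\mathcal{H}})D^{(n)}\bigr]^{-1}(Q(X)\otimes I_{\mathcal{H}})C^{(n)}$$ for all $n\in\mathbb{N}$ and all $X\in\mathbb{D}_Q\cap(M_{n\times n}\otimes\mathbb{C}^d)$, where $\mathcal{H}$ is a Hilbert space and $$V=\begin{bmatrix}A&B\\ C&D\end{bmatrix}:\begin{bmatrix}\mathbb{C}\\ \mathbb{C}^s\otimes\mathcal{H}\end{bmatrix}\to\begin{bmatrix}\mathbb{C}\\ \mathbb{C}^r\otimes\mathcal{H}\end{bmatrix}$$ is a unitary operator. Then $$\bigl(BP(f,1)\cap\partial_{\mathrm{iso}}\mathbb{D}_Q\bigr)\cup\bigl(BP^*(f,1)\cap\partial_{\mathrm{coiso}}\mathbb{D}_Q\bigr)\subseteq\sigma_{ap}^Q(D^* ).$$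
   Context: $\mathbb{M}^d=\bigsqcup_{n\in\mathbb{N}}M_{n\times n}\otimes\mathbb{C}^d$ is the disjoint union over $n$ of the spaces of $d$-tuples $X=(X_1,\dots,X_d)$ of complex $n\times n$ matrices (level $n$); for $\Omega\subset\mathbb{M}^d$, $\Omega_n=\Omega\cap(M_{n\times n}\otimes\mathbb{C}^d)$. For $X$ at level $n$, $Q(X)=\sum_jQ_j\otimes X_j:\mathbb{C}^r\otimes\mathbb{C}^n\to\mathbb{C}^s\otimes\mathbb{C}^n$. $\mathbb{D}_Q=\{X\in\mathbb{M}^d:\|Q(X)\|<1\}$ and $\partial\mathbb{D}_Q=\{X\in\mathbb{M}^d:\|Q(X)\|=1\}$ (operator norm). An NC function $f:\mathbb{D}_Q\to\mathbb{M}^1$ is a map such that: $f(X)\in M_{n\times n}$ for $X$ at level $n$; $f(X\oplus Y)=f(X)\oplus f(Y)$ (direct sums taken componentwise); and $f(S^{-1}XS)=S^{-1}f(X)S$ whenever $X\in(\mathbb{D}_Q)_n$, $S\in GL_n$ and $S^{-1}XS=(S^{-1}X_1S,\dots,S^{-1}X_dS)\in(\mathbb{D}_Q)_n$. $\mathcal{SA}(\mathbb{D}_Q)$ is the set of NC functions $f:\mathbb{D}_Q\to\mathbb{M}^1$ with $\sup_{X\in\mathbb{D}_Q}\|f(X)\|\le1$. For an operator $T$, $T^{(n)}=T\otimes I_n$. For $X$ at level $n$, $Q(X)\otimes I_{\mathcal{H}}$ denotes, after the obvious reordering of tensor factors, the operator $\sum_jQ_j\otimes I_{\mathcal{H}}\otimes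 X_j:\mathbb{C}^r\otimes\mathcal{H}\otimes\mathbb{C}^n\to\mathbb{C}^s\otimes\mathcal{H}\otimes\mathbb{C}^n$. Boundary values: $BP(f)$ is the set of $\Lambda\in\partial\mathbb{D}_Q$ for which $f^\dagger(\Lambda):=\lim_{r\to1^-}f(r\Lambda)$ exists. $BP(f,1)$ is the set of $\Lambda\in BP(f)_n$, $n\in\mathbb{N}$, such that $\|f^\dagger(\Lambda)y\|<\|y\|$ for some $0\ne y\in\mathbb{C}^n$ (i.e. $f^\dagger(\Lambda)$ is not an isometry). $BP^*(f,1)$ is the set of $\Lambda\in BP(f)_n$, $n\in\mathbb{N}$, such that $\|y^*f^\dagger(\Lambda)\|<\|y^*\|$ for some $0\ne y\in\mathbb{C}^n$, where $y^*$ is the functional $v\mapsto\langle v,y\rangle$ (i.e. $f^\dagger(\Lambda)$ is not a coisometry). $\partial_{\mathrm{iso}}\mathbb{D}_Q=\{\Lambda\in\mathbb{M}^d:Q(\Lambda)^*Q(\Lambda)=I\}$ and $\partial_{\mathrm{coiso}}\mathbb{D}_Q=\{\Lambda\in\mathbb{M}^d:Q(\Lambda)Q(\Lambda)^*=I\}$, where for $\Lambda$ at level $n$ the identity is that of $\mathbb{C}^r\otimes\mathbb{C}^n$, respectively $\mathbb{C}^s\otimes\mathbb{C}^n$. NC $Q$-approximate spectrum: for $T\in\mathcal{B}(\mathbb{C}^r\otimes\mathcal{H},\mathbb{C}^s\otimes\mathcal{H})$, $\Lambda\in M_{n\times n}\otimes\mathbb{C}^d$ is an NC $Q$-approximate eigenvalue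 of $T$ at level $n$ if there is a sequence of unit vectors $\vec v_k\in\mathbb{C}^r\otimes\mathcal{H}\otimes\mathbb{C}^n$ with $\lim_{k\to\infty}\|T^{(n)}\vec v_k-(Q(\Lambda)\otimes I_{\mathcal{H}})\vec v_k\|=0$. $\sigma_{ap}^Q(T)$ is the set (disjoint union over $n$) of all NC $Q$-approximate eigenvalues of $T$. *)

theory Defs
  imports "HOL-Analysis.Analysis" "Jordan_Normal_Form.Matrix"
begin

no_notation Matrix.vec_index (infixl \<open>$\<close> 100)
notation Matrix.vec_index (infixl \<open>$\<^sub>v\<close> 100)

text \<open>Two library types of vectors are in use.  The type \<open>'a ^ 'b\<close> has a fixed finite index type,
  and its components are written \<open>x $ a\<close>; the type \<open>'a Matrix.vec\<close> of \<^const>\<open>carrier_vec\<close> has a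
  variable length, and its components are written \<open>v $\<^sub>v i\<close>.\<close>

section \<open>Complex Hilbert spaces\<close>

text \<open>The inner product is linear in the first argument, and the underlying real inner product
  (hence norm and topology) is its real part.\<close>

class complex_hilbert = real_inner + complete_space +
  fixes scaleC :: "complex \<Rightarrow> 'a \<Rightarrow> 'a"  (infixr \<open>*\<^sub>C\<close> 75)
    and cinner :: "'a \<Rightarrow> 'a \<Rightarrow> complex"
  assumes scaleC_add_right: "c *\<^sub>C (x + y) = c *\<^sub>C x + c *\<^sub>C y"
    and scaleC_add_left: "(c + d) *\<^sub>C x = c *\<^sub>C x + d *\<^sub>C x"
    and scaleC_scaleC: "c *\<^sub>C d *\<^sub>C x = (c * d) *\<^sub>C x"
    and scaleC_of_real: "complex_of_real t *\<^sub>C x = t *\<^sub>R x"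
    and cinner_add_left: "cinner (x + y) z = cinner x z + cinner y z"
    and cinner_scaleC_left: "cinner (c *\<^sub>C x) y = c * cinner x y"
    and cinner_commute: "cinner x y = cnj (cinner y x)"
    and inner_eq_Re_cinner: "inner x y = Re (cinner x y)"

instantiation complex :: complex_hilbert
begin
definition scaleC_complex :: "complex \<Rightarrow> complex \<Rightarrow> complex" where "scaleC_complex c x = c * x"
definition cinner_complex :: "complex \<Rightarrow> complex \<Rightarrow> complex" where "cinner_complex x y = x * cnj y"
instance
  by standard (auto simp: scaleC_complex_def cinner_complex_def algebra_simps
      scaleR_conv_of_real inner_complex_def)
end

instantiation Finite_Cartesian_Product.vec :: (complex_hilbert, finite) complex_hilbert
begin
definition scaleC_vec :: "complex \<Rightarrow> 'a ^ 'b \<Rightarrow> 'a ^ 'b"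
  where "scaleC_vec c x = (\<chi> a. c *\<^sub>C (x $ a))"
definition cinner_vec :: "'a ^ 'b \<Rightarrow> 'a ^ 'b \<Rightarrow> complex"
  where "cinner_vec x y = (\<Sum>a\<in>UNIV. cinner (x $ a) (y $ a))"
instance
proof
  fix x y z :: "'a ^ 'b" and c d :: complex and t :: real
  show "cinner x y = cnj (cinner y x)"
    unfolding cinner_vec_def cnj_sum by (rule sum.cong) (auto intro: cinner_commute)
qed (auto simp: scaleC_vec_def cinner_vec_def Finite_Cartesian_Product.vec_eq_iff inner_vec_def
      scaleC_add_right scaleC_add_left scaleC_scaleC scaleC_of_real cinner_add_left
      cinner_scaleC_left inner_eq_Re_cinner sum.distrib sum_distrib_left)
end

instantiation prod :: (complex_hilbert, complex_hilbert) complex_hilbert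
begin
definition scaleC_prod :: "complex \<Rightarrow> 'a \<times> 'b \<Rightarrow> 'a \<times> 'b"
  where "scaleC_prod c x = (c *\<^sub>C fst x, c *\<^sub>C snd x)"
definition cinner_prod :: "'a \<times> 'b \<Rightarrow> 'a \<times> 'b \<Rightarrow> complex"
  where "cinner_prod x y = cinner (fst x) (fst y) + cinner (snd x) (snd y)"
instance
proof
  fix x y z :: "'a \<times> 'b" and c d :: complex and t :: real
  show "cinner x y = cnj (cinner y x)"
    unfolding cinner_prod_def by (simp flip: cinner_commute)
qed (auto simp: scaleC_prod_def cinner_prod_def prod_eq_iff inner_prod_def
      scaleC_add_right scaleC_add_left scaleC_scaleC scaleC_of_real cinner_add_left
      cinner_scaleC_left inner_eq_Re_cinner algebra_simps)
end

definition bounded_clinear :: "('a::complex_hilbert \<Rightarrow> 'b::complex_hilbert) \<Rightarrow> bool" where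
  "bounded_clinear T \<longleftrightarrow> bounded_linear T \<and> (\<forall>c x. T (c *\<^sub>C x) = c *\<^sub>C T x)"

definition unitary_op :: "('a::complex_hilbert \<Rightarrow> 'b::complex_hilbert) \<Rightarrow> bool" where
  "unitary_op V \<longleftrightarrow> bounded_clinear V \<and> (\<forall>x y. cinner (V x) (V y) = cinner x y) \<and> surj V"

text \<open>The description below is uniquely satisfiable for every bounded operator (Riesz).\<close>

definition cadjoint :: "('a::complex_hilbert \<Rightarrow> 'b::complex_hilbert) \<Rightarrow> 'b \<Rightarrow> 'a" where
  "cadjoint T w = (THE u. \<forall>v. cinner (T v) w = cinner v u)"

definition clin_indep_family :: "('i::finite \<Rightarrow> 'a::complex_hilbert) \<Rightarrow> bool" where
  "clin_indep_family b \<longleftrightarrow> (\<forall>c. (\<Sum>j\<in>UNIV. c j *\<^sub>C b j) = 0 \<longrightarrow> (\<forall>j. c j = 0))"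

section \<open>The spaces \<open>K \<otimes> \<complex>\<^sup>n\<close>\<close>

text \<open>For a Hilbert space \<open>K\<close>, the space \<open>K \<otimes> \<complex>\<^sup>n\<close> is the set \<open>carrier_vec n\<close> of
  \<open>n\<close>-tuples from \<open>K\<close>: the tuple \<open>v\<close> stands for the sum of the \<open>v $\<^sub>v i \<otimes> e\<^sub>i\<close>.  Thus
  \<open>T \<otimes> I\<^sub>n\<close> is \<open>map_vec T\<close>, and \<open>\<complex>\<^sup>r \<otimes> K\<close> is the type of families in \<open>K\<close> indexed by a
  type with \<open>r\<close> elements.\<close>

definition tinner :: "'k::complex_hilbert Matrix.vec \<Rightarrow> 'k Matrix.vec \<Rightarrow> complex" where
  "tinner v w = (\<Sum>i<dim_vec v. cinner (v $\<^sub>v i) (w $\<^sub>v i))"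

definition tnorm :: "'k::complex_hilbert Matrix.vec \<Rightarrow> real" where
  "tnorm v = sqrt (\<Sum>i<dim_vec v. (norm (v $\<^sub>v i))\<^sup>2)"

definition level_norm ::
    "nat \<Rightarrow> ('k::complex_hilbert Matrix.vec \<Rightarrow> 'l::complex_hilbert Matrix.vec) \<Rightarrow> real" where
  "level_norm n T = Sup {tnorm (T v) | v. v \<in> carrier_vec n \<and> tnorm v \<le> 1}"

definition level_adjoint ::
    "nat \<Rightarrow> ('k::complex_hilbert Matrix.vec \<Rightarrow> 'l::complex_hilbert Matrix.vec)
      \<Rightarrow> 'l Matrix.vec \<Rightarrow> 'k Matrix.vec" where
  "level_adjoint n T w =
     (THE u. u \<in> carrier_vec n \<and> (\<forall>v\<in>carrier_vec n. tinner (T v) w = tinner v u))"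

definition mat_norm :: "complex mat \<Rightarrow> real" where
  "mat_norm M = level_norm (dim_col M) (\<lambda>v. M *\<^sub>v v)"

section \<open>NC matrix unit balls\<close>

text \<open>A point of \<open>\<bbbM>\<^sup>d\<close> is a family of square matrices of a common size, indexed by a type with
  \<open>d\<close> elements; levels start at 1.\<close>

definition nc_level :: "nat \<Rightarrow> ('d \<Rightarrow> complex mat) set" where
  "nc_level n = {X. \<forall>j. X j \<in> carrier_mat n n}"

text \<open>The operator from \<open>\<complex>\<^sup>r \<otimes> \<H> \<otimes> \<complex>\<^sup>n\<close> to \<open>\<complex>\<^sup>s \<otimes> \<H> \<otimes> \<complex>\<^sup>n\<close> given by the sum of the
  \<open>Q\<^sub>j \<otimes> I \<otimes> X\<^sub>j\<close>, for arbitrary \<open>\<H>\<close>; the case \<open>\<H> = \<complex>\<close> is \<open>Q(X)\<close> itself.\<close>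

definition nc_lin ::
    "('d::finite \<Rightarrow> complex ^ 'r ^ 's) \<Rightarrow> ('d \<Rightarrow> complex mat)
      \<Rightarrow> ('h::complex_hilbert ^ 'r) Matrix.vec \<Rightarrow> ('h ^ 's) Matrix.vec" where
  "nc_lin Q X v = Matrix.vec (dim_vec v) (\<lambda>i. \<chi> a.
     \<Sum>j\<in>UNIV. \<Sum>b\<in>UNIV. \<Sum>k<dim_vec v. (Q j $ a $ b * X j $$ (i, k)) *\<^sub>C (v $\<^sub>v k $ b))"

abbreviation nc_eval ::
    "('d::finite \<Rightarrow> complex ^ 'r ^ 's) \<Rightarrow> ('d \<Rightarrow> complex mat)
      \<Rightarrow> (complex ^ 'r) Matrix.vec \<Rightarrow> (complex ^ 's) Matrix.vec" where
  "nc_eval \<equiv> nc_lin"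

definition nc_ball :: "('d::finite \<Rightarrow> complex ^ 'r ^ 's) \<Rightarrow> ('d \<Rightarrow> complex mat) set" where
  "nc_ball Q = {X. \<exists>n>0. X \<in> nc_level n \<and> level_norm n (nc_eval Q X) < 1}"

definition nc_sphere :: "('d::finite \<Rightarrow> complex ^ 'r ^ 's) \<Rightarrow> ('d \<Rightarrow> complex mat) set" where
  "nc_sphere Q = {X. \<exists>n>0. X \<in> nc_level n \<and> level_norm n (nc_eval Q X) = 1}"

definition iso_boundary :: "('d::finite \<Rightarrow> complex ^ 'r ^ 's) \<Rightarrow> ('d \<Rightarrow> complex mat) set" where
  "iso_boundary Q = {\<Lambda>. \<exists>n>0. \<Lambda> \<in> nc_level n \<and>
     (\<forall>v\<in>carrier_vec n. level_adjoint n (nc_eval Q \<Lambda>) (nc_eval Q \<Lambda> v) = v)}"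

definition coiso_boundary :: "('d::finite \<Rightarrow> complex ^ 'r ^ 's) \<Rightarrow> ('d \<Rightarrow> complex mat) set" where
  "coiso_boundary Q = {\<Lambda>. \<exists>n>0. \<Lambda> \<in> nc_level n \<and>
     (\<forall>w\<in>carrier_vec n. nc_eval Q \<Lambda> (level_adjoint n (nc_eval Q \<Lambda>) w) = w)}"

section \<open>NC functions and boundary values\<close>

text \<open>Only the values on the ball matter; elsewhere the total function \<open>f\<close> is arbitrary.\<close>

definition nc_function ::
    "('d::finite \<Rightarrow> complex ^ 'r ^ 's) \<Rightarrow> (('d \<Rightarrow> complex mat) \<Rightarrow> complex mat) \<Rightarrow> bool" where
  "nc_function Q f \<longleftrightarrow>
     (\<forall>n. \<forall>X\<in>nc_ball Q \<inter> nc_level n. f X \<in> carrier_mat n n) \<and>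
     (\<forall>X\<in>nc_ball Q. \<forall>Y\<in>nc_ball Q.
        f (\<lambda>j. diag_block_mat [X j, Y j]) = diag_block_mat [f X, f Y]) \<and>
     (\<forall>n. \<forall>X\<in>nc_ball Q \<inter> nc_level n. \<forall>S\<in>carrier_mat n n. \<forall>S'\<in>carrier_mat n n.
        inverts_mat S S' \<longrightarrow> inverts_mat S' S \<longrightarrow> (\<lambda>j. S' * X j * S) \<in> nc_ball Q \<longrightarrow>
        f (\<lambda>j. S' * X j * S) = S' * f X * S)"

definition schur_agler ::
    "('d::finite \<Rightarrow> complex ^ 'r ^ 's) \<Rightarrow> (('d \<Rightarrow> complex mat) \<Rightarrow> complex mat) set" where
  "schur_agler Q = {f. nc_function Q f \<and> (\<forall>X\<in>nc_ball Q. mat_norm (f X) \<le> 1)}"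

text \<open>A constant NC function takes the value \<open>c I\<^sub>n\<close> at every point of level \<open>n\<close>.\<close>

definition nc_constant ::
    "('d::finite \<Rightarrow> complex ^ 'r ^ 's) \<Rightarrow> (('d \<Rightarrow> complex mat) \<Rightarrow> complex mat) \<Rightarrow> bool" where
  "nc_constant Q f \<longleftrightarrow>
     (\<exists>c. \<forall>n. \<forall>X\<in>nc_ball Q \<inter> nc_level n. f X = c \<cdot>\<^sub>m 1\<^sub>m n)"

definition has_boundary_value ::
    "(('d \<Rightarrow> complex mat) \<Rightarrow> complex mat) \<Rightarrow> ('d \<Rightarrow> complex mat) \<Rightarrow> complex mat \<Rightarrow> bool" where
  "has_boundary_value f \<Lambda> L \<longleftrightarrow> (\<exists>n. \<Lambda> \<in> nc_level n \<and> L \<in> carrier_mat n n \<and>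
     ((\<lambda>t::real. mat_norm (f (\<lambda>j. complex_of_real t \<cdot>\<^sub>m \<Lambda> j) - L)) \<longlongrightarrow> 0) (at_left 1))"

definition boundary_value ::
    "(('d \<Rightarrow> complex mat) \<Rightarrow> complex mat) \<Rightarrow> ('d \<Rightarrow> complex mat) \<Rightarrow> complex mat" where
  "boundary_value f \<Lambda> = (THE L. has_boundary_value f \<Lambda> L)"

definition BP ::
    "('d::finite \<Rightarrow> complex ^ 'r ^ 's) \<Rightarrow> (('d \<Rightarrow> complex mat) \<Rightarrow> complex mat)
      \<Rightarrow> ('d \<Rightarrow> complex mat) set" where
  "BP Q f = {\<Lambda> \<in> nc_sphere Q. \<exists>L. has_boundary_value f \<Lambda> L}"

definition BP1 ::
    "('d::finite \<Rightarrow> complex ^ 'r ^ 's) \<Rightarrow> (('d \<Rightarrow> complex mat) \<Rightarrow> complex mat)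
      \<Rightarrow> ('d \<Rightarrow> complex mat) set" where
  "BP1 Q f = {\<Lambda> \<in> BP Q f. \<exists>n. \<Lambda> \<in> nc_level n \<and>
     (\<exists>y\<in>carrier_vec n. y \<noteq> 0\<^sub>v n \<and> tnorm (boundary_value f \<Lambda> *\<^sub>v y) < tnorm y)}"

text \<open>The functional \<open>y\<^sup>*\<close> as a matrix with one row, so that \<open>y\<^sup>* M\<close> is a matrix product.\<close>

definition row_star :: "complex Matrix.vec \<Rightarrow> complex mat" where
  "row_star y = mat_of_rows (dim_vec y) [map_vec cnj y]"

definition BP1_star ::
    "('d::finite \<Rightarrow> complex ^ 'r ^ 's) \<Rightarrow> (('d \<Rightarrow> complex mat) \<Rightarrow> complex mat)
      \<Rightarrow> ('d \<Rightarrow> complex mat) set" where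
  "BP1_star Q f = {\<Lambda> \<in> BP Q f. \<exists>n. \<Lambda> \<in> nc_level n \<and>
     (\<exists>y\<in>carrier_vec n. y \<noteq> 0\<^sub>v n \<and>
        mat_norm (row_star y * boundary_value f \<Lambda>) < mat_norm (row_star y))}"

section \<open>Realizations and the approximate spectrum\<close>

definition level_inverse ::
    "nat \<Rightarrow> ('k Matrix.vec \<Rightarrow> 'k Matrix.vec) \<Rightarrow> 'k Matrix.vec \<Rightarrow> 'k Matrix.vec" where
  "level_inverse n T = the_inv_into (carrier_vec n) T"

text \<open>In \<open>unitary_realization\<close> the operator to be inverted is a bijection of \<open>carrier_vec n\<close>, since
  \<open>nc_lin Q X\<close> is a strict contraction at points of the ball and \<open>D\<close> is a contraction.\<close>

definition unitary_realization ::
    "('d::finite \<Rightarrow> complex ^ 'r ^ 's) \<Rightarrow> (('d \<Rightarrow> complex mat) \<Rightarrow> complex mat)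
      \<Rightarrow> (complex \<Rightarrow> complex) \<Rightarrow> ('h::complex_hilbert ^ 's \<Rightarrow> complex)
      \<Rightarrow> (complex \<Rightarrow> 'h ^ 'r) \<Rightarrow> ('h ^ 's \<Rightarrow> 'h ^ 'r) \<Rightarrow> bool" where
  "unitary_realization Q f A B C D \<longleftrightarrow>
     bounded_clinear A \<and> bounded_clinear B \<and> bounded_clinear C \<and> bounded_clinear D \<and>
     unitary_op (\<lambda>(z, h). (A z + B h, C z + D h)) \<and>
     (\<forall>n. \<forall>X\<in>nc_ball Q \<inter> nc_level n. \<forall>u\<in>carrier_vec n.
        f X *\<^sub>v u = map_vec A u +
          map_vec B (level_inverse n (\<lambda>w. w - nc_lin Q X (map_vec D w))
            (nc_lin Q X (map_vec C u))))"

definition approx_spectrum ::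
    "('d::finite \<Rightarrow> complex ^ 'r ^ 's) \<Rightarrow> ('h::complex_hilbert ^ 'r \<Rightarrow> 'h ^ 's)
      \<Rightarrow> ('d \<Rightarrow> complex mat) set" where
  "approx_spectrum Q T = {\<Lambda>. \<exists>n>0. \<Lambda> \<in> nc_level n \<and>
     (\<exists>v. (\<forall>k::nat. v k \<in> carrier_vec n \<and> tnorm (v k) = 1) \<and>
        (\<lambda>k. tnorm (map_vec T (v k) - nc_lin Q \<Lambda> (v k))) \<longlonglongrightarrow> 0)}"

end

theory Submission
  imports Defs
begin

text \<open>Write \<open>Z\<close> for the operator \<open>Q(\<Lambda>) \<otimes> I\<close> at a boundary point \<open>\<Lambda>\<close>, and \<open>V\<close> for the
  unitary colligation with blocks \<open>A\<close>, \<open>B\<close>, \<open>C\<close>, \<open>D\<close>.  The realization formula at \<open>t\<Lambda>\<close>, for \<open>0 < t < 1\<close>, says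
  that \<open>V\<close> maps \<open>(y, x)\<close> to \<open>(f(t\<Lambda>)y, w)\<close>, where \<open>x = tZw\<close> and \<open>w = Cy + Dx\<close>.

  Suppose that \<open>Z\<close> is an isometry.  As \<open>V\<close> preserves norms,
  \<open>(1 - t\<^sup>2) \<parallel>w\<parallel>\<^sup>2 = \<parallel>y\<parallel>\<^sup>2 - \<parallel>f(t\<Lambda>)y\<parallel>\<^sup>2\<close>.  If the boundary value shrinks \<open>y\<close>, then the right-hand side
  stays away from 0 as \<open>t \<rightarrow> 1\<close>, so that \<open>\<parallel>w\<parallel>\<close> tends to infinity.  The second component of
  \<open>V\<^sup>*(f(t\<Lambda>)y, w) = (y, x)\<close> reads \<open>B\<^sup>*f(t\<Lambda>)y + D\<^sup>*w = tZw\<close>, and thus \<open>D\<^sup>*w - Zw\<close> has norm at most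
  \<open>(1 - t)\<parallel>w\<parallel> + \<parallel>y\<parallel>\<close>.  After division by \<open>\<parallel>w\<parallel>\<close> this tends to 0: the normalized \<open>w\<close> are approximate
  eigenvectors of \<open>D\<^sup>*\<close>.

  If \<open>Z\<close> is a coisometry, the argument is run on \<open>V\<^sup>*\<close>.  The resolvent of \<open>tZ\<^sup>*D\<^sup>*\<close> gives \<open>u\<close> with
  \<open>u = tZ\<^sup>*m\<close> and \<open>m = B\<^sup>*y + D\<^sup>*u\<close>, and \<open>V\<^sup>*\<close> maps \<open>(y, u)\<close> to \<open>(f(t\<Lambda>)\<^sup>*y, m)\<close>.  Again
  \<open>(1 - t\<^sup>2) \<parallel>m\<parallel>\<^sup>2 = \<parallel>y\<parallel>\<^sup>2 - \<parallel>f(t\<Lambda>)\<^sup>*y\<parallel>\<^sup>2\<close>, so that \<open>\<parallel>u\<parallel> = t\<parallel>m\<parallel>\<close> tends to infinity, while \<open>ZZ\<^sup>* = I\<close> gives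
  \<open>D\<^sup>*u - Zu = (1 - t)m - B\<^sup>*y\<close>.

  The two cases are \<open>isometric_case\<close> and \<open>coisometric_case\<close>; the passage to approximate eigenvectors
  is \<open>approx_spectrum_of_blowup\<close>.  The hypotheses on \<open>\<Lambda>\<close> concern \<open>Q(\<Lambda>)\<close> alone and reach \<open>Z\<close>
  through \<open>tensor_identity_transfer\<close>.  All adjoints of blocks of \<open>V\<close> are read off from the inverse of \<open>V\<close>, and the
  resolvents come from the contraction principle on a level.\<close>

section \<open>Complex Hilbert spaces\<close>

lemma cinner_zero_left [simp]: "cinner 0 (y::'a::complex_hilbert) = 0"
  using cinner_add_left[of 0 0 y] by simp

lemma cinner_zero_right [simp]: "cinner (x::'a::complex_hilbert) 0 = 0"
  using cinner_commute[of x 0] by simp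

lemma cinner_add_right: "cinner (x::'a::complex_hilbert) (y + z) = cinner x y + cinner x z"
  by (metis cinner_add_left cinner_commute complex_cnj_add)

lemma cinner_scaleC_right: "cinner (x::'a::complex_hilbert) (c *\<^sub>C y) = cnj c * cinner x y"
  by (metis cinner_scaleC_left cinner_commute complex_cnj_mult)

lemma cinner_sum_left: "cinner (\<Sum>i\<in>I. g i) (y::'a::complex_hilbert) = (\<Sum>i\<in>I. cinner (g i) y)"
  by (induction I rule: infinite_finite_induct) (auto simp: cinner_add_left)

lemma cinner_sum_right: "cinner (y::'a::complex_hilbert) (\<Sum>i\<in>I. g i) = (\<Sum>i\<in>I. cinner y (g i))"
  by (induction I rule: infinite_finite_induct) (auto simp: cinner_add_right)

lemma cinner_minus_right: "cinner (x::'a::complex_hilbert) (- y) = - cinner x y"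
  using cinner_add_right[of x y "- y"] by (simp add: add_eq_0_iff)

lemma cinner_diff_right: "cinner (x::'a::complex_hilbert) (y - z) = cinner x y - cinner x z"
  using cinner_add_right[of x y "- z"] by (simp add: cinner_minus_right)

lemma norm_sq_eq_Re_cinner: "(norm (x::'a::complex_hilbert))\<^sup>2 = Re (cinner x x)"
  by (simp add: power2_norm_eq_inner inner_eq_Re_cinner)

lemma cinner_ext_right:
  assumes "\<And>v. cinner v x = cinner v (y::'a::complex_hilbert)"
  shows "x = y"
proof -
  have "cinner (x - y) (x - y) = 0"
    using assms[of "x - y"] by (simp add: cinner_diff_right)
  then have "(norm (x - y))\<^sup>2 = 0" by (simp only: norm_sq_eq_Re_cinner) simp
  then show ?thesis by simp
qed

lemma cinner_ext_left:
  assumes "\<And>v. cinner x v = cinner (y::'a::complex_hilbert) v"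
  shows "x = y"
  by (rule cinner_ext_right) (metis assms cinner_commute)

section \<open>Norm and inner product on levels\<close>

lemma tnorm_eq_L2: "v \<in> carrier_vec n \<Longrightarrow> tnorm v = L2_set (\<lambda>i. norm (v $\<^sub>v i)) {..<n}"
  by (simp add: tnorm_def L2_set_def)

lemma tnorm_sq: "v \<in> carrier_vec n \<Longrightarrow> (tnorm v)\<^sup>2 = (\<Sum>i<n. (norm (v $\<^sub>v i))\<^sup>2)"
  by (simp add: tnorm_def sum_nonneg)

lemma tnorm_sq_eq_Re_tinner: "(tnorm v)\<^sup>2 = Re (tinner v v)"
  by (simp add: tnorm_def tinner_def sum_nonneg flip: norm_sq_eq_Re_cinner)

lemma tnorm_nonneg [simp]: "0 \<le> tnorm v"
  by (simp add: tnorm_def sum_nonneg)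

lemma tnorm_zero_iff:
  assumes "v \<in> carrier_vec n" shows "tnorm v = 0 \<longleftrightarrow> v = 0\<^sub>v n"
  using assms by (auto simp: tnorm_def sum_nonneg_eq_0_iff intro!: Matrix.eq_vecI)

lemma tnorm_0 [simp]: "tnorm (0\<^sub>v n :: 'k::complex_hilbert Matrix.vec) = 0"
  using tnorm_zero_iff[OF zero_carrier_vec] by blast

lemma tnorm_triangle:
  assumes "v \<in> carrier_vec n" "w \<in> carrier_vec n"
  shows "tnorm (v + w) \<le> tnorm v + tnorm w"
proof -
  have "tnorm (v + w) = L2_set (\<lambda>i. norm (v $\<^sub>v i + w $\<^sub>v i)) {..<n}"
    using assms by (subst tnorm_eq_L2[of _ n]) (auto intro!: L2_set_cong)
  also have "\<dots> \<le> L2_set (\<lambda>i. norm (v $\<^sub>v i) + norm (w $\<^sub>v i)) {..<n}"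
    by (rule L2_set_mono) (auto simp: norm_triangle_ineq)
  also have "\<dots> \<le> tnorm v + tnorm w"
    using L2_set_triangle_ineq assms by (simp add: tnorm_eq_L2)
  finally show ?thesis .
qed

lemma tnorm_diff_triangle:
  assumes "v \<in> carrier_vec n" "w \<in> carrier_vec n"
  shows "tnorm (v - w) \<le> tnorm v + tnorm w"
proof -
  have "v - w = v + (- w)" using assms by auto
  moreover have "tnorm (- w) = tnorm w" using assms by (simp add: tnorm_def)
  ultimately show ?thesis using tnorm_triangle[of v n "- w"] assms by simp
qed

lemma tnorm_scaleR:
  "tnorm (map_vec ((*\<^sub>R) c) v) = \<bar>c\<bar> * tnorm v"
  by (simp add: tnorm_def power_mult_distrib sum_distrib_left[symmetric] real_sqrt_mult)

lemma tnorm_map_le: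
  assumes "\<And>x. norm (T x) \<le> norm x"
  shows "tnorm (map_vec T v) \<le> tnorm v"
  unfolding tnorm_def using assms by (auto intro!: sum_mono power_mono)

lemma norm_index_le_tnorm:
  assumes "i < dim_vec v" shows "norm (v $\<^sub>v i) \<le> tnorm v"
proof -
  have "(norm (v $\<^sub>v i))\<^sup>2 \<le> (tnorm v)\<^sup>2"
    unfolding tnorm_sq[OF carrier_vec_dim_vec]
    using assms by (intro member_le_sum) auto
  then show ?thesis by (simp add: power2_le_iff_abs_le)
qed

text \<open>The Cauchy-Schwarz inequality, in the real form that suffices to bound an operator by its adjoint.\<close>

lemma Re_tinner_le:
  assumes "v \<in> carrier_vec n" "w \<in> carrier_vec n"
  shows "Re (tinner v w) \<le> tnorm v * tnorm w"
proof -
  have "Re (tinner v w) = (\<Sum>i<n. inner (v $\<^sub>v i) (w $\<^sub>v i))"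
    using assms by (simp add: tinner_def inner_eq_Re_cinner)
  also have "\<dots> \<le> (\<Sum>i<n. \<bar>norm (v $\<^sub>v i)\<bar> * \<bar>norm (w $\<^sub>v i)\<bar>)"
    by (intro sum_mono) (simp add: norm_cauchy_schwarz)
  also have "\<dots> \<le> tnorm v * tnorm w"
    using L2_set_mult_ineq[of "\<lambda>i. norm (v $\<^sub>v i)" "\<lambda>i. norm (w $\<^sub>v i)" "{..<n}"] assms
    by (simp add: tnorm_eq_L2)
  finally show ?thesis .
qed

lemma tinner_ext_right:
  assumes u: "u \<in> carrier_vec n" and u': "u' \<in> carrier_vec n"
    and eq: "\<And>v. v \<in> carrier_vec n \<Longrightarrow> tinner v u = tinner v u'"
  shows "u = u'"
proof -
  have "tinner (u - u') (u - u') = tinner (u - u') u - tinner (u - u') u'"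
    using u u' by (simp add: tinner_def cinner_diff_right sum_subtractf)
  then have "(tnorm (u - u'))\<^sup>2 = 0"
    using u u' by (simp add: eq tnorm_sq_eq_Re_tinner)
  then have "u - u' = 0\<^sub>v n" using u u' tnorm_zero_iff[of "u - u'" n] by simp
  then have "u $\<^sub>v i - u' $\<^sub>v i = 0" if "i < n" for i
    using u u' that by (metis carrier_vecD index_minus_vec(1) index_zero_vec(1))
  then show ?thesis using u u' by (intro Matrix.eq_vecI) auto
qed

lemma level_adjoint_eqI:
  assumes "u \<in> carrier_vec n" "\<And>v. v \<in> carrier_vec n \<Longrightarrow> tinner (T v) w = tinner v u"
  shows "level_adjoint n T w = u"
  unfolding level_adjoint_def
proof (rule the_equality)
  fix u' assume "u' \<in> carrier_vec n \<and> (\<forall>v\<in>carrier_vec n. tinner (T v) w = tinner v u')"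
  then show "u' = u" using assms by (intro tinner_ext_right) auto
qed (use assms in auto)

text \<open>A level is complete, so that a contraction has a unique fixed point on it; this is how
  the resolvents \<open>(I - G)\<^sup>-\<^sup>1\<close> below are obtained.\<close>

text \<open>The metric of a level is written as an expression that is symmetric for all pairs of vectors:
  a metric space constrains its distance function also outside the carrier, where \<open>tnorm (v - w)\<close>
  depends on the dimension of \<open>w\<close> alone.\<close>

lemma Metric_space_level:
  "Metric_space (carrier_vec n :: 'k::complex_hilbert Matrix.vec set)
     (\<lambda>v w. L2_set (\<lambda>i. norm (v $\<^sub>v i - w $\<^sub>v i)) {..<n})"
proof
  fix x y z :: "'k Matrix.vec"
  show "0 \<le> L2_set (\<lambda>i. norm (x $\<^sub>v i - y $\<^sub>v i)) {..<n}" by simp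
  show "L2_set (\<lambda>i. norm (x $\<^sub>v i - y $\<^sub>v i)) {..<n} = L2_set (\<lambda>i. norm (y $\<^sub>v i - x $\<^sub>v i)) {..<n}"
    by (simp add: norm_minus_commute)
  assume x: "x \<in> carrier_vec n" and y: "y \<in> carrier_vec n"
  then show "L2_set (\<lambda>i. norm (x $\<^sub>v i - y $\<^sub>v i)) {..<n} = 0 \<longleftrightarrow> x = y"
    by (auto simp: L2_set_eq_0_iff intro!: Matrix.eq_vecI)
  have "L2_set (\<lambda>i. norm (x $\<^sub>v i - z $\<^sub>v i)) {..<n}
      \<le> L2_set (\<lambda>i. norm (x $\<^sub>v i - y $\<^sub>v i) + norm (y $\<^sub>v i - z $\<^sub>v i)) {..<n}"
    by (rule L2_set_mono) (auto intro: norm_diff_triangle_le)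
  also have "\<dots> \<le> L2_set (\<lambda>i. norm (x $\<^sub>v i - y $\<^sub>v i)) {..<n}
      + L2_set (\<lambda>i. norm (y $\<^sub>v i - z $\<^sub>v i)) {..<n}"
    by (rule L2_set_triangle_ineq)
  finally show "L2_set (\<lambda>i. norm (x $\<^sub>v i - z $\<^sub>v i)) {..<n}
    \<le> L2_set (\<lambda>i. norm (x $\<^sub>v i - y $\<^sub>v i)) {..<n} + L2_set (\<lambda>i. norm (y $\<^sub>v i - z $\<^sub>v i)) {..<n}" .
qed

lemma mcomplete_level:
  "Metric_space.mcomplete (carrier_vec n :: 'k::complex_hilbert Matrix.vec set)
     (\<lambda>v w. L2_set (\<lambda>i. norm (v $\<^sub>v i - w $\<^sub>v i)) {..<n})"
proof -
  interpret Metric_space "carrier_vec n :: 'k Matrix.vec set"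
    "\<lambda>v w. L2_set (\<lambda>i. norm (v $\<^sub>v i - w $\<^sub>v i)) {..<n}"
    by (rule Metric_space_level)
  show ?thesis
    unfolding mcomplete_def
  proof (intro allI impI)
    fix \<sigma> :: "nat \<Rightarrow> 'k Matrix.vec" assume \<sigma>: "MCauchy \<sigma>"
    have "convergent (\<lambda>m. \<sigma> m $\<^sub>v i)" if i: "i < n" for i
    proof (rule Cauchy_convergent, rule metric_CauchyI)
      fix e :: real assume "e > 0"
      then obtain N where N: "\<And>m m'. N \<le> m \<Longrightarrow> N \<le> m'
          \<Longrightarrow> L2_set (\<lambda>i. norm (\<sigma> m $\<^sub>v i - \<sigma> m' $\<^sub>v i)) {..<n} < e"
        using \<sigma> unfolding MCauchy_def by blast
      have "dist (\<sigma> m $\<^sub>v i) (\<sigma> m' $\<^sub>v i) < e" if "m \<ge> N" "m' \<ge> N" for m m'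
        using member_le_L2_set[of "{..<n}" i "\<lambda>i. norm (\<sigma> m $\<^sub>v i - \<sigma> m' $\<^sub>v i)"] N[OF that] i
        by (simp add: dist_norm)
      then show "\<exists>N. \<forall>m\<ge>N. \<forall>m'\<ge>N. dist (\<sigma> m $\<^sub>v i) (\<sigma> m' $\<^sub>v i) < e" by blast
    qed
    then have lim: "(\<lambda>m. \<sigma> m $\<^sub>v i) \<longlonglongrightarrow> lim (\<lambda>m. \<sigma> m $\<^sub>v i)" if "i < n" for i
      using that by (simp add: convergent_LIMSEQ_iff)
    define x where "x = Matrix.vec n (\<lambda>i. lim (\<lambda>m. \<sigma> m $\<^sub>v i))"
    have "(\<lambda>m. sqrt (\<Sum>i<n. (norm (\<sigma> m $\<^sub>v i - x $\<^sub>v i))\<^sup>2))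
        \<longlonglongrightarrow> sqrt (\<Sum>i<n. (norm (lim (\<lambda>m. \<sigma> m $\<^sub>v i) - x $\<^sub>v i))\<^sup>2)"
      by (intro tendsto_intros) (auto intro: lim)
    then have "(\<lambda>m. L2_set (\<lambda>i. norm (\<sigma> m $\<^sub>v i - x $\<^sub>v i)) {..<n}) \<longlonglongrightarrow> 0"
      by (simp add: L2_set_def x_def)
    then show "\<exists>x. limitin mtopology \<sigma> x sequentially"
      using \<sigma> unfolding limitin_metric_dist_null MCauchy_def
      by (intro exI[of _ x]) (auto simp: x_def intro!: always_eventually)
  qed
qed

text \<open>Solving \<open>w - G w = v\<close> means finding a fixed point of \<open>w \<mapsto> v + G w\<close>.  The bound on \<open>G\<close>
  is a Lipschitz condition because that is the hypothesis of the contraction principle.\<close>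

lemma ex1_resolvent:
  fixes G :: "'k::complex_hilbert Matrix.vec \<Rightarrow> 'k Matrix.vec"
  assumes G: "\<And>w. w \<in> carrier_vec n \<Longrightarrow> G w \<in> carrier_vec n"
    and lip: "\<And>v w. v \<in> carrier_vec n \<Longrightarrow> w \<in> carrier_vec n \<Longrightarrow>
      tnorm (G v - G w) \<le> t * tnorm (v - w)"
    and t: "t < 1" and v: "v \<in> carrier_vec n"
  shows "\<exists>!w. w \<in> carrier_vec n \<and> w - G w = v"
proof -
  let ?d = "\<lambda>v w :: 'k Matrix.vec. L2_set (\<lambda>i. norm (v $\<^sub>v i - w $\<^sub>v i)) {..<n}"
  interpret Metric_space "carrier_vec n :: 'k Matrix.vec set" ?d
    by (rule Metric_space_level)
  have d: "?d a b = tnorm (a - b)" if "a \<in> carrier_vec n" "b \<in> carrier_vec n" for a b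
    using that by (subst tnorm_eq_L2[of _ n]) (auto intro!: L2_set_cong)
  have dv: "?d (v + G a) (v + G b) = tnorm (G a - G b)"
    if "a \<in> carrier_vec n" "b \<in> carrier_vec n" for a b
  proof -
    have "G a \<in> carrier_vec n" "G b \<in> carrier_vec n" using G that by auto
    then show ?thesis using v by (simp add: d[symmetric] cong: L2_set_cong_simp)
  qed
  have "\<exists>!w. w \<in> carrier_vec n \<and> v + G w = w"
  proof -
    have con: "?d (v + G a) (v + G b) \<le> t * ?d a b"
      if "a \<in> carrier_vec n" "b \<in> carrier_vec n" for a b
      unfolding dv[OF that] d[OF that] using lip[OF that] .
    have "(\<lambda>w. v + G w) \<in> carrier_vec n \<rightarrow> carrier_vec n" using G v by auto
    then obtain w where w: "w \<in> carrier_vec n" "v + G w = w"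
      using Banach_fixedpoint_thm[OF mcomplete_level _ _ t con] v by blast
    moreover have "w' = w" if "w' \<in> carrier_vec n" "v + G w' = w'" for w'
      using contraction_imp_unique_fixpoint[OF that(2) w(2) _ t con that(1) w(1)] G v by auto
    ultimately show ?thesis by blast
  qed
  moreover have "w - G w = v \<longleftrightarrow> v + G w = w" if w: "w \<in> carrier_vec n" for w
  proof -
    have Gw: "G w \<in> carrier_vec n" using G w by auto
    show ?thesis
    proof
      assume "w - G w = v"
      then show "v + G w = w" using w Gw by (auto intro!: Matrix.eq_vecI)
    next
      assume "v + G w = w"
      then have "w - G w = (v + G w) - G w" by simp
      then show "w - G w = v" using v Gw by (auto intro!: Matrix.eq_vecI)
    qed
  qed
  ultimately show ?thesis by (metis (mono_tags, lifting))
qed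

section \<open>The operators of a point and their adjoints\<close>

lemma dim_nc_lin [simp]: "dim_vec (nc_lin Q X v) = dim_vec v"
  unfolding nc_lin_def by (rule dim_vec)

lemma nc_lin_carrier [simp]: "v \<in> carrier_vec n \<Longrightarrow> nc_lin Q X v \<in> carrier_vec n"
  by (rule carrier_vecI) (simp only: dim_nc_lin carrier_vecD)

lemma nc_lin_index:
  assumes "v \<in> carrier_vec n" "i < n"
  shows "nc_lin Q X v $\<^sub>v i $ a =
    (\<Sum>j\<in>UNIV. \<Sum>b\<in>UNIV. \<Sum>k<n. (Q j $ a $ b * X j $$ (i, k)) *\<^sub>C (v $\<^sub>v k $ b))"
  using assms by (auto simp: nc_lin_def)

lemma scaleC_diff_right: "c *\<^sub>C (x - y) = c *\<^sub>C x - c *\<^sub>C (y::'a::complex_hilbert)"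
  using scaleC_add_right[of c "x - y" y] by (simp add: algebra_simps)

lemma scaleC_scaleR: "c *\<^sub>C t *\<^sub>R x = t *\<^sub>R c *\<^sub>C (x::'a::complex_hilbert)"
  by (metis mult.commute scaleC_of_real scaleC_scaleC)

lemma nc_lin_diff:
  assumes "v \<in> carrier_vec n" "w \<in> carrier_vec n"
  shows "nc_lin Q X (v - w) = nc_lin Q X v - nc_lin Q X w"
proof (rule Matrix.eq_vecI)
  fix i assume "i < dim_vec (nc_lin Q X v - nc_lin Q X w)"
  then have i: "i < n" using assms by simp
  show "nc_lin Q X (v - w) $\<^sub>v i = (nc_lin Q X v - nc_lin Q X w) $\<^sub>v i"
    unfolding Finite_Cartesian_Product.vec_eq_iff
    using assms i by (simp add: nc_lin_index[of _ n] scaleC_diff_right sum_subtractf)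
qed (use assms in auto)

lemma nc_lin_scaleR:
  "nc_lin Q X (map_vec ((*\<^sub>R) t) v) = map_vec ((*\<^sub>R) t) (nc_lin Q X v)"
proof (rule Matrix.eq_vecI)
  fix i assume "i < dim_vec (map_vec ((*\<^sub>R) t) (nc_lin Q X v))"
  then have i: "i < dim_vec v" by simp
  show "nc_lin Q X (map_vec ((*\<^sub>R) t) v) $\<^sub>v i = map_vec ((*\<^sub>R) t) (nc_lin Q X v) $\<^sub>v i"
    unfolding Finite_Cartesian_Product.vec_eq_iff
    using i by (simp add: nc_lin_def scaleC_scaleR scaleR_right.sum)
qed auto

lemma nc_level_unique:
  assumes "X \<in> nc_level m" "X \<in> nc_level n" shows "m = n"
  using assms by (metis (mono_tags) carrier_matD(1) mem_Collect_eq nc_level_def)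

lemma nc_lin_scale_point:
  assumes X: "X \<in> nc_level n" and v: "v \<in> carrier_vec n"
  shows "nc_lin Q (\<lambda>j. complex_of_real t \<cdot>\<^sub>m X j) v = map_vec ((*\<^sub>R) t) (nc_lin Q X v)"
proof (rule Matrix.eq_vecI)
  fix i assume "i < dim_vec (map_vec ((*\<^sub>R) t) (nc_lin Q X v))"
  then have i: "i < n" using v by simp
  have *: "(q * (complex_of_real t \<cdot>\<^sub>m X j) $$ (i, k)) *\<^sub>C x = t *\<^sub>R ((q * X j $$ (i, k)) *\<^sub>C x)"
    if "k < n" for k j q and x :: "'h::complex_hilbert"
  proof -
    have "X j \<in> carrier_mat n n" using X by (simp add: nc_level_def)
    then have "(complex_of_real t \<cdot>\<^sub>m X j) $$ (i, k) = complex_of_real t * X j $$ (i, k)"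
      using i that by auto
    then show ?thesis by (metis mult.left_commute scaleC_of_real scaleC_scaleC)
  qed
  show "nc_lin Q (\<lambda>j. complex_of_real t \<cdot>\<^sub>m X j) v $\<^sub>v i
      = map_vec ((*\<^sub>R) t) (nc_lin Q X v) $\<^sub>v i"
    unfolding Finite_Cartesian_Product.vec_eq_iff
    using i v by (simp add: nc_lin_index[of _ n] * scaleR_right.sum)
qed auto

text \<open>The adjoint of \<open>nc_lin Q X\<close> is again of the form \<open>nc_lin\<close>, for the adjoint coefficients and the
  adjoint matrices; hence every fact about \<open>nc_lin\<close> also serves for adjoints.\<close>

definition adjoint_coeffs :: "('d \<Rightarrow> complex ^ 'r ^ 's) \<Rightarrow> 'd \<Rightarrow> complex ^ 's ^ 'r" where
  "adjoint_coeffs Q = (\<lambda>j. \<chi> b a. cnj (Q j $ a $ b))"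

definition mat_star :: "complex mat \<Rightarrow> complex mat" where
  "mat_star M = map_mat cnj (transpose_mat M)"

lemma mat_star_carrier [simp]: "M \<in> carrier_mat n m \<Longrightarrow> mat_star M \<in> carrier_mat m n"
  by (auto simp: mat_star_def)

lemma mat_star_index:
  "M \<in> carrier_mat n m \<Longrightarrow> i < m \<Longrightarrow> j < n \<Longrightarrow> mat_star M $$ (i, j) = cnj (M $$ (j, i))"
  by (auto simp: mat_star_def)

abbreviation nc_lin_star ::
  "('d::finite \<Rightarrow> complex ^ 'r::finite ^ 's::finite) \<Rightarrow> ('d \<Rightarrow> complex mat)
    \<Rightarrow> ('h::complex_hilbert ^ 's) Matrix.vec \<Rightarrow> ('h ^ 'r) Matrix.vec" where
  "nc_lin_star Q X \<equiv> nc_lin (adjoint_coeffs Q) (\<lambda>j. mat_star (X j))"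

lemma tinner_nc_lin:
  assumes X: "X \<in> nc_level n" and v: "v \<in> carrier_vec n" and w: "w \<in> carrier_vec n"
  shows "tinner (nc_lin Q X v) w = tinner v (nc_lin_star Q X w)"
proof -
  have X': "X j \<in> carrier_mat n n" for j using X by (simp add: nc_level_def)
  have "tinner (nc_lin Q X v) w = (\<Sum>i<n. \<Sum>a\<in>UNIV. \<Sum>j\<in>UNIV. \<Sum>b\<in>UNIV. \<Sum>k<n.
      Q j $ a $ b * X j $$ (i, k) * cinner (v $\<^sub>v k $ b) (w $\<^sub>v i $ a))"
    using v by (simp add: tinner_def cinner_vec_def nc_lin_index[of _ n] cinner_sum_left
        cinner_scaleC_left)
  also have "\<dots> = (\<Sum>(i, a, j, b, k) \<in> {..<n} \<times> UNIV \<times> UNIV \<times> UNIV \<times> {..<n}.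
      Q j $ a $ b * X j $$ (i, k) * cinner (v $\<^sub>v k $ b) (w $\<^sub>v i $ a))"
    by (simp add: sum.cartesian_product)
  also have "\<dots> = (\<Sum>(k, b, j, a, i) \<in> {..<n} \<times> UNIV \<times> UNIV \<times> UNIV \<times> {..<n}.
      Q j $ a $ b * X j $$ (i, k) * cinner (v $\<^sub>v k $ b) (w $\<^sub>v i $ a))"
    by (rule sum.reindex_bij_witness[of _ "\<lambda>(k, b, j, a, i). (i, a, j, b, k)"
          "\<lambda>(i, a, j, b, k). (k, b, j, a, i)"]) auto
  also have "\<dots> = (\<Sum>k<n. \<Sum>b\<in>UNIV. \<Sum>j\<in>UNIV. \<Sum>a\<in>UNIV. \<Sum>i<n.
      Q j $ a $ b * X j $$ (i, k) * cinner (v $\<^sub>v k $ b) (w $\<^sub>v i $ a))"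
    by (simp add: sum.cartesian_product)
  also have "\<dots> = tinner v (nc_lin_star Q X w)"
    using v w by (simp add: tinner_def cinner_vec_def nc_lin_index[of _ n] cinner_sum_right
        cinner_scaleC_right adjoint_coeffs_def mat_star_index[OF X'])
  finally show ?thesis .
qed

text \<open>The operator acts by scalars on the factor \<open>\<H>\<close>, so that it commutes with linear maps on that factor.\<close>

lemma nc_lin_map_functional:
  fixes \<phi> :: "'h::complex_hilbert \<Rightarrow> 'g::complex_hilbert"
  assumes add: "\<And>x y. \<phi> (x + y) = \<phi> x + \<phi> y" and scale: "\<And>c x. \<phi> (c *\<^sub>C x) = c *\<^sub>C \<phi> x"
  shows "nc_lin Q X (map_vec (\<lambda>x. \<chi> b. \<phi> (x $ b)) v) = map_vec (\<lambda>x. \<chi> a. \<phi> (x $ a)) (nc_lin Q X v)"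
proof -
  have zero: "\<phi> 0 = 0" using add[of 0 0] by simp
  have sum: "\<phi> (sum g I) = (\<Sum>i\<in>I. \<phi> (g i))" for g and I :: "'i set"
    by (induction I rule: infinite_finite_induct) (auto simp: zero add)
  show ?thesis
    by (intro Matrix.eq_vecI; simp add: nc_lin_def Finite_Cartesian_Product.vec_eq_iff sum scale)
qed

text \<open>An identity between \<open>Q(X)\<close> and its adjoint passes to \<open>Q(X) \<otimes> I\<close>: the functionals
  \<open>\<langle>\<cdot>, h\<rangle>\<close> commute with the operators, map vectors over \<open>\<H>\<close> to scalar vectors, and separate the
  points of \<open>\<H>\<close>.\<close>

lemma tensor_identity_transfer:
  fixes v :: "('h::complex_hilbert ^ 'r::finite) Matrix.vec"
    and P :: "'d::finite \<Rightarrow> complex ^ 's::finite ^ 'r" and Q :: "'e::finite \<Rightarrow> complex ^ 'r ^ 's"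
  assumes id: "\<And>u :: (complex ^ 'r) Matrix.vec. u \<in> carrier_vec n \<Longrightarrow> nc_lin P Y (nc_lin Q X u) = u"
    and v: "v \<in> carrier_vec n"
  shows "nc_lin P Y (nc_lin Q X v) = v"
proof (rule Matrix.eq_vecI)
  fix i assume "i < dim_vec v"
  then have i: "i < n" using v by auto
  have "cinner (nc_lin P Y (nc_lin Q X v) $\<^sub>v i $ b) h = cinner (v $\<^sub>v i $ b) h" for b h
  proof -
    define \<phi> where "\<phi> = (\<lambda>x. cinner x h)"
    have \<phi>: "\<phi> (x + y) = \<phi> x + \<phi> y" "\<phi> (c *\<^sub>C x) = c *\<^sub>C \<phi> x" for x y c
      by (simp_all add: \<phi>_def cinner_add_left cinner_scaleC_left scaleC_complex_def)
    have "map_vec (\<lambda>x. \<chi> a. \<phi> (x $ a)) (nc_lin P Y (nc_lin Q X v))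
        = nc_lin P Y (nc_lin Q X (map_vec (\<lambda>x. \<chi> a. \<phi> (x $ a)) v))"
      by (simp add: nc_lin_map_functional[OF \<phi>])
    also have "\<dots> = map_vec (\<lambda>x. \<chi> a. \<phi> (x $ a)) v"
      using v by (intro id) simp
    finally have "map_vec (\<lambda>x. \<chi> a. \<phi> (x $ a)) (nc_lin P Y (nc_lin Q X v)) $\<^sub>v i $ b
        = map_vec (\<lambda>x. \<chi> a. \<phi> (x $ a)) v $\<^sub>v i $ b" by simp
    then show ?thesis using i v by (simp add: \<phi>_def)
  qed
  then show "nc_lin P Y (nc_lin Q X v) $\<^sub>v i = v $\<^sub>v i"
    by (auto simp: Finite_Cartesian_Product.vec_eq_iff intro: cinner_ext_left)
qed simp

lemma level_adjoint_nc_lin: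
  assumes "X \<in> nc_level n" "w \<in> carrier_vec n"
  shows "level_adjoint n (nc_lin Q X) w = nc_lin_star Q X w"
  using assms by (intro level_adjoint_eqI) (auto simp: tinner_nc_lin)

lemma iso_boundary_star_mult:
  fixes v :: "('h::complex_hilbert ^ 'r::finite) Matrix.vec"
    and Q :: "'d::finite \<Rightarrow> complex ^ 'r ^ 's::finite"
  assumes iso: "\<Lambda> \<in> iso_boundary Q" and \<Lambda>: "\<Lambda> \<in> nc_level n" and v: "v \<in> carrier_vec n"
  shows "nc_lin_star Q \<Lambda> (nc_lin Q \<Lambda> v) = v"
proof (rule tensor_identity_transfer[OF _ v])
  fix u :: "(complex ^ 'r) Matrix.vec" assume u: "u \<in> carrier_vec n"
  obtain m where m: "\<Lambda> \<in> nc_level m"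
    "\<And>v. v\<in>carrier_vec m \<Longrightarrow> level_adjoint m (nc_eval Q \<Lambda>) (nc_eval Q \<Lambda> v) = v"
    using iso by (auto simp: iso_boundary_def)
  have "m = n" using nc_level_unique[OF m(1) \<Lambda>] .
  then show "nc_lin_star Q \<Lambda> (nc_lin Q \<Lambda> u) = u"
    using m(2)[of u] u by (simp add: level_adjoint_nc_lin[OF \<Lambda>])
qed

lemma coiso_boundary_mult_star:
  fixes w :: "('h::complex_hilbert ^ 's::finite) Matrix.vec"
    and Q :: "'d::finite \<Rightarrow> complex ^ 'r::finite ^ 's"
  assumes coiso: "\<Lambda> \<in> coiso_boundary Q" and \<Lambda>: "\<Lambda> \<in> nc_level n" and w: "w \<in> carrier_vec n"
  shows "nc_lin Q \<Lambda> (nc_lin_star Q \<Lambda> w) = w"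
proof (rule tensor_identity_transfer[OF _ w])
  fix u :: "(complex ^ 's) Matrix.vec" assume u: "u \<in> carrier_vec n"
  obtain m where m: "\<Lambda> \<in> nc_level m"
    "\<And>w. w\<in>carrier_vec m \<Longrightarrow> nc_eval Q \<Lambda> (level_adjoint m (nc_eval Q \<Lambda>) w) = w"
    using coiso by (auto simp: coiso_boundary_def)
  have "m = n" using nc_level_unique[OF m(1) \<Lambda>] .
  then show "nc_lin Q \<Lambda> (nc_lin_star Q \<Lambda> u) = u"
    using m(2)[of u] u by (simp add: level_adjoint_nc_lin[OF \<Lambda>])
qed

lemma tnorm_nc_lin_iso:
  assumes "\<Lambda> \<in> iso_boundary Q" "\<Lambda> \<in> nc_level n" "v \<in> carrier_vec n"
  shows "tnorm (nc_lin Q \<Lambda> v) = tnorm v"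
proof -
  have "(tnorm (nc_lin Q \<Lambda> v))\<^sup>2 = (tnorm v)\<^sup>2"
    unfolding tnorm_sq_eq_Re_tinner
    using assms by (simp add: tinner_nc_lin iso_boundary_star_mult)
  then show ?thesis by simp
qed

lemma tnorm_nc_lin_star_coiso:
  assumes "\<Lambda> \<in> coiso_boundary Q" "\<Lambda> \<in> nc_level n" "w \<in> carrier_vec n"
  shows "tnorm (nc_lin_star Q \<Lambda> w) = tnorm w"
proof -
  have "tinner (nc_lin_star Q \<Lambda> w) (nc_lin_star Q \<Lambda> w) = tinner w w"
    using assms tinner_nc_lin[of \<Lambda> n "nc_lin_star Q \<Lambda> w" w Q]
    by (simp add: coiso_boundary_mult_star)
  then have "(tnorm (nc_lin_star Q \<Lambda> w))\<^sup>2 = (tnorm w)\<^sup>2"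
    unfolding tnorm_sq_eq_Re_tinner by simp
  then show ?thesis by simp
qed

text \<open>Here \<open>\<parallel>Zv\<parallel>\<^sup>2 = \<langle>v, Z\<^sup>*Zv\<rangle> \<le> \<parallel>v\<parallel> \<parallel>Zv\<parallel>\<close>, since \<open>Z\<^sup>*\<close> is isometric.\<close>

lemma tnorm_nc_lin_coiso_le:
  assumes "\<Lambda> \<in> coiso_boundary Q" "\<Lambda> \<in> nc_level n" "v \<in> carrier_vec n"
  shows "tnorm (nc_lin Q \<Lambda> v) \<le> tnorm v"
proof -
  have "(tnorm (nc_lin Q \<Lambda> v))\<^sup>2 = Re (tinner v (nc_lin_star Q \<Lambda> (nc_lin Q \<Lambda> v)))"
    unfolding tnorm_sq_eq_Re_tinner using assms by (simp add: tinner_nc_lin)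
  also have "\<dots> \<le> tnorm v * tnorm (nc_lin Q \<Lambda> v)"
    using Re_tinner_le[of v n "nc_lin_star Q \<Lambda> (nc_lin Q \<Lambda> v)"] assms
    by (simp add: tnorm_nc_lin_star_coiso)
  finally show ?thesis
    using tnorm_nonneg[of "nc_lin Q \<Lambda> v"] tnorm_nonneg[of v]
    by (metis antisym_conv1 mult_right_le_imp_le power2_eq_square)
qed

lemma scaled_point_in_ball:
  assumes \<Lambda>: "\<Lambda> \<in> nc_level n" and n: "n > 0" and t: "0 \<le> t" "t < 1"
    and le: "\<And>v :: (complex ^ 'r::finite) Matrix.vec. v \<in> carrier_vec n \<Longrightarrow>
      tnorm (nc_lin Q \<Lambda> v) \<le> tnorm v"
  shows "(\<lambda>j. complex_of_real t \<cdot>\<^sub>m \<Lambda> j) \<in> nc_ball (Q :: 'd::finite \<Rightarrow> complex ^ 'r ^ 's::finite)"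
proof -
  have lev: "(\<lambda>j. complex_of_real t \<cdot>\<^sub>m \<Lambda> j) \<in> nc_level n" using \<Lambda> by (simp add: nc_level_def)
  have "level_norm n (nc_eval Q (\<lambda>j. complex_of_real t \<cdot>\<^sub>m \<Lambda> j)) \<le> t"
    unfolding level_norm_def
  proof (rule cSup_least)
    have "0\<^sub>v n \<in> carrier_vec n \<and> tnorm (0\<^sub>v n :: (complex ^ 'r) Matrix.vec) \<le> 1" by simp
    then show "{tnorm (nc_eval Q (\<lambda>j. complex_of_real t \<cdot>\<^sub>m \<Lambda> j) v) |v.
        v \<in> carrier_vec n \<and> tnorm v \<le> 1} \<noteq> {}" by blast
    fix x assume "x \<in> {tnorm (nc_eval Q (\<lambda>j. complex_of_real t \<cdot>\<^sub>m \<Lambda> j) v) |v.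
        v \<in> carrier_vec n \<and> tnorm v \<le> 1}"
    then obtain v :: "(complex ^ 'r) Matrix.vec" where v: "v \<in> carrier_vec n" "tnorm v \<le> 1"
      and x: "x = tnorm (nc_eval Q (\<lambda>j. complex_of_real t \<cdot>\<^sub>m \<Lambda> j) v)" by blast
    have "x = t * tnorm (nc_lin Q \<Lambda> v)"
      using v t \<Lambda> by (simp add: x nc_lin_scale_point tnorm_scaleR)
    also have "\<dots> \<le> t * 1" using le[OF v(1)] v(2) t by (intro mult_left_mono) auto
    finally show "x \<le> t" by simp
  qed
  then show ?thesis using lev n t unfolding nc_ball_def by force
qed

section \<open>Matrix norms and boundary values\<close>

lemma tinner_mult_mat_vec:
  assumes M: "M \<in> carrier_mat n n" and x: "x \<in> carrier_vec n" and y: "y \<in> carrier_vec n"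
  shows "tinner (M *\<^sub>v x) y = tinner x (mat_star M *\<^sub>v y)"
proof -
  have "tinner (M *\<^sub>v x) y = (\<Sum>i<n. \<Sum>k<n. M $$ (i, k) * x $\<^sub>v k * cnj (y $\<^sub>v i))"
    using M x by (simp add: tinner_def cinner_complex_def scalar_prod_def sum_distrib_right
        atLeast0LessThan)
  also have "\<dots> = (\<Sum>k<n. \<Sum>i<n. M $$ (i, k) * x $\<^sub>v k * cnj (y $\<^sub>v i))" by (rule sum.swap)
  also have "\<dots> = tinner x (mat_star M *\<^sub>v y)"
    using M x y by (simp add: tinner_def cinner_complex_def scalar_prod_def sum_distrib_left
        atLeast0LessThan mat_star_def mult_ac)
  finally show ?thesis .
qed

text \<open>The operator norm is a supremum of reals, which says something about the individual values only once
  they are known to be bounded.\<close>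

lemma tnorm_mult_mat_vec_bounded:
  fixes M :: "complex mat"
  assumes M: "M \<in> carrier_mat m n"
  shows "bdd_above {tnorm (M *\<^sub>v v) | v. v \<in> carrier_vec n \<and> tnorm v \<le> 1}"
proof (rule bdd_aboveI)
  fix c assume "c \<in> {tnorm (M *\<^sub>v v) | v. v \<in> carrier_vec n \<and> tnorm v \<le> 1}"
  then obtain v where v: "v \<in> carrier_vec n" "tnorm v \<le> 1" and c: "c = tnorm (M *\<^sub>v v)" by blast
  have vk: "norm (v $\<^sub>v k) \<le> 1" if "k < n" for k
    using norm_index_le_tnorm[of k v] v that by auto
  have "norm ((M *\<^sub>v v) $\<^sub>v i) \<le> (\<Sum>k<n. norm (M $$ (i, k)))" if i: "i < m" for i
  proof -
    have "(M *\<^sub>v v) $\<^sub>v i = (\<Sum>k<n. M $$ (i, k) * v $\<^sub>v k)"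
      using M v i by (auto simp: scalar_prod_def atLeast0LessThan)
    also have "norm \<dots> \<le> (\<Sum>k<n. norm (M $$ (i, k)))"
      using vk by (intro sum_norm_le) (simp add: norm_mult mult_left_le)
    finally show ?thesis .
  qed
  then have "tnorm (M *\<^sub>v v) \<le> sqrt (\<Sum>i<m. (\<Sum>k<n. norm (M $$ (i, k)))\<^sup>2)"
    unfolding tnorm_def using M by (auto intro!: sum_mono power_mono)
  then show "c \<le> sqrt (\<Sum>i<m. (\<Sum>k<n. norm (M $$ (i, k)))\<^sup>2)" by (simp add: c)
qed

lemma tnorm_mult_le_mat_norm:
  assumes M: "M \<in> carrier_mat m n" and v: "v \<in> carrier_vec n" "tnorm v \<le> 1"
  shows "tnorm (M *\<^sub>v v) \<le> mat_norm M"
  unfolding mat_norm_def level_norm_def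
  by (rule cSup_upper) (use assms tnorm_mult_mat_vec_bounded[OF M] in auto)

lemma norm_entry_le_mat_norm:
  assumes M: "M \<in> carrier_mat m n" and i: "i < m" "j < n"
  shows "norm (M $$ (i, j)) \<le> mat_norm M"
proof -
  let ?e = "unit_vec n j :: complex Matrix.vec"
  have "(\<Sum>i<n. (norm (?e $\<^sub>v i))\<^sup>2) = (\<Sum>i<n. if i = j then 1 else 0)"
    using i by (intro sum.cong) auto
  then have e: "tnorm ?e = 1" using i by (simp add: tnorm_def)
  have "norm ((M *\<^sub>v ?e) $\<^sub>v i) \<le> tnorm (M *\<^sub>v ?e)"
    using M i by (intro norm_index_le_tnorm) auto
  also have "\<dots> \<le> mat_norm M" using M e by (intro tnorm_mult_le_mat_norm) auto
  finally show ?thesis using M i by (simp add: scalar_prod_right_unit)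
qed

text \<open>The upper bound is the Cauchy-Schwarz inequality, and it is attained at the normalized vector \<open>z\<close>.\<close>

lemma mat_norm_row_star:
  assumes "z \<in> carrier_vec n"
  shows "mat_norm (row_star z) = tnorm z"
proof -
  have carr: "row_star z \<in> carrier_mat 1 n"
    using assms by (auto simp: row_star_def mat_of_rows_def)
  have app: "(row_star z *\<^sub>v v) $\<^sub>v 0 = (\<Sum>k<n. cnj (z $\<^sub>v k) * v $\<^sub>v k)"
    "dim_vec (row_star z *\<^sub>v v) = 1" if "v \<in> carrier_vec n" for v
    using assms that by (auto simp: row_star_def mat_of_rows_def scalar_prod_def atLeast0LessThan)
  have t: "tnorm (row_star z *\<^sub>v v) = norm (\<Sum>k<n. cnj (z $\<^sub>v k) * v $\<^sub>v k)"
    if "v \<in> carrier_vec n" for v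
    using app[OF that] by (simp add: tnorm_def)
  show ?thesis
  proof (rule antisym)
    show "mat_norm (row_star z) \<le> tnorm z"
      unfolding mat_norm_def level_norm_def
    proof (rule cSup_least)
      have "0\<^sub>v n \<in> carrier_vec n \<and> tnorm (0\<^sub>v n :: complex Matrix.vec) \<le> 1" by simp
      then show "{tnorm (row_star z *\<^sub>v v) |v. v \<in> carrier_vec (dim_col (row_star z)) \<and> tnorm v \<le> 1} \<noteq> {}"
        using carr by (metis (mono_tags, lifting) Collect_empty_eq carrier_matD(2))
      fix x assume "x \<in> {tnorm (row_star z *\<^sub>v v) |v. v \<in> carrier_vec (dim_col (row_star z)) \<and> tnorm v \<le> 1}"
      then obtain v where v: "v \<in> carrier_vec n" "tnorm v \<le> 1" and x: "x = tnorm (row_star z *\<^sub>v v)"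
        using carr by auto
      have "x \<le> (\<Sum>k<n. \<bar>norm (z $\<^sub>v k)\<bar> * \<bar>norm (v $\<^sub>v k)\<bar>)"
        unfolding x t[OF v(1)] by (intro sum_norm_le) (simp add: norm_mult)
      also have "\<dots> \<le> tnorm z * tnorm v"
        unfolding tnorm_eq_L2[OF v(1)] tnorm_eq_L2[OF assms] by (rule L2_set_mult_ineq)
      also have "\<dots> \<le> tnorm z" using v by (simp add: mult_left_le)
      finally show "x \<le> tnorm z" .
    qed
    show "tnorm z \<le> mat_norm (row_star z)"
    proof (cases "tnorm z = 0")
      case True
      have "tnorm (row_star z *\<^sub>v 0\<^sub>v n) \<le> mat_norm (row_star z)"
        by (rule tnorm_mult_le_mat_norm[OF carr]) auto
      then show ?thesis using True order_trans[OF tnorm_nonneg] by simp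
    next
      case False
      define v where "v = map_vec ((*\<^sub>R) (1 / tnorm z)) z"
      have v: "v \<in> carrier_vec n" "tnorm v = 1"
        using assms False by (auto simp: v_def tnorm_scaleR)
      have "(\<Sum>k<n. cnj (z $\<^sub>v k) * v $\<^sub>v k) = complex_of_real ((1 / tnorm z) * (\<Sum>k<n. (norm (z $\<^sub>v k))\<^sup>2))"
        using assms unfolding of_real_mult of_real_sum sum_distrib_left
        by (intro sum.cong) (auto simp: v_def scaleR_conv_of_real mult_ac simp flip: complex_norm_square)
      also have "(1 / tnorm z) * (\<Sum>k<n. (norm (z $\<^sub>v k))\<^sup>2) = tnorm z"
        unfolding tnorm_sq[OF assms, symmetric] using False by (simp add: power2_eq_square)
      finally have "tnorm (row_star z *\<^sub>v v) = tnorm z" using t[OF v(1)] by simp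
      then show ?thesis using tnorm_mult_le_mat_norm[OF carr v(1)] v(2) by simp
    qed
  qed
qed

text \<open>With this lemma and \<open>mat_norm_row_star\<close>, the condition \<open>\<parallel>y\<^sup>*L\<parallel> < \<parallel>y\<^sup>*\<parallel>\<close> becomes \<open>\<parallel>L\<^sup>*y\<parallel> < \<parallel>y\<parallel>\<close>.\<close>

lemma row_star_mult:
  assumes M: "M \<in> carrier_mat n n" and y: "y \<in> carrier_vec n"
  shows "row_star y * M = row_star (mat_star M *\<^sub>v y)"
  using M y
  by (intro eq_matI) (auto simp: row_star_def mat_of_rows_def scalar_prod_def atLeast0LessThan
      mat_star_def mult_ac)

text \<open>Entrywise convergence is what is used of the boundary value: it determines the limit and is
  inherited by the adjoint matrices.\<close>

lemma has_boundary_value_entry: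
  assumes bv: "has_boundary_value f \<Lambda> L" and \<Lambda>: "\<Lambda> \<in> nc_level n" 
    and f: "\<And>t. 0 < t \<Longrightarrow> t < 1 \<Longrightarrow> f (\<lambda>j. complex_of_real t \<cdot>\<^sub>m \<Lambda> j) \<in> carrier_mat n n"
  shows "L \<in> carrier_mat n n"
    and "i < n \<Longrightarrow> k < n \<Longrightarrow>
      ((\<lambda>t. f (\<lambda>j. complex_of_real t \<cdot>\<^sub>m \<Lambda> j) $$ (i, k)) \<longlongrightarrow> L $$ (i, k)) (at_left 1)"
proof -
  obtain m where m: "\<Lambda> \<in> nc_level m" "L \<in> carrier_mat m m"
    and lim: "((\<lambda>t::real. mat_norm (f (\<lambda>j. complex_of_real t \<cdot>\<^sub>m \<Lambda> j) - L)) \<longlongrightarrow> 0) (at_left 1)"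
    using bv unfolding has_boundary_value_def by blast
  have "m = n" using nc_level_unique[OF m(1) \<Lambda>] .
  then show L: "L \<in> carrier_mat n n" using m by simp
  assume ik: "i < n" "k < n"
  have "((\<lambda>t. f (\<lambda>j. complex_of_real t \<cdot>\<^sub>m \<Lambda> j) $$ (i, k) - L $$ (i, k)) \<longlongrightarrow> 0) (at_left 1)"
  proof (rule Lim_null_comparison[OF _ lim])
    have "\<forall>\<^sub>F t::real in at_left 1. 0 < t \<and> t < 1"
      using eventually_at_left_real[of 0 1] by simp
    then show "\<forall>\<^sub>F t in at_left 1. norm (f (\<lambda>j. complex_of_real t \<cdot>\<^sub>m \<Lambda> j) $$ (i, k) - L $$ (i, k))
        \<le> mat_norm (f (\<lambda>j. complex_of_real t \<cdot>\<^sub>m \<Lambda> j) - L)"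
    proof (rule eventually_mono)
      fix t :: real assume "0 < t \<and> t < 1"
      then have ft: "f (\<lambda>j. complex_of_real t \<cdot>\<^sub>m \<Lambda> j) \<in> carrier_mat n n" using f by simp
      then show "norm (f (\<lambda>j. complex_of_real t \<cdot>\<^sub>m \<Lambda> j) $$ (i, k) - L $$ (i, k))
          \<le> mat_norm (f (\<lambda>j. complex_of_real t \<cdot>\<^sub>m \<Lambda> j) - L)"
        using norm_entry_le_mat_norm[of "f (\<lambda>j. complex_of_real t \<cdot>\<^sub>m \<Lambda> j) - L" n n i k] L ik
          minus_carrier_mat[OF L]
        by simp
    qed
  qed
  then show "((\<lambda>t. f (\<lambda>j. complex_of_real t \<cdot>\<^sub>m \<Lambda> j) $$ (i, k)) \<longlongrightarrow> L $$ (i, k)) (at_left 1)"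
    by (simp add: LIM_zero_iff)
qed

lemma boundary_value_eqI:
  assumes bv: "has_boundary_value f \<Lambda> L" and \<Lambda>: "\<Lambda> \<in> nc_level n" 
    and f: "\<And>t. 0 < t \<Longrightarrow> t < 1 \<Longrightarrow> f (\<lambda>j. complex_of_real t \<cdot>\<^sub>m \<Lambda> j) \<in> carrier_mat n n"
  shows "boundary_value f \<Lambda> = L"
  unfolding boundary_value_def
proof (rule the_equality)
  fix L' assume bv': "has_boundary_value f \<Lambda> L'"
  note c = has_boundary_value_entry[OF bv \<Lambda> f] and c' = has_boundary_value_entry[OF bv' \<Lambda> f]
  show "L' = L"
  proof (rule eq_matI)
    fix i j assume "i < dim_row L" "j < dim_col L"
    then have "i < n" "j < n" using c(1) by auto
    then show "L' $$ (i, j) = L $$ (i, j)"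
      using tendsto_unique[OF _ c'(2) c(2)] by simp
  qed (use c(1) c'(1) in auto)
qed (fact bv)

lemma tendsto_tnorm_mult:
  fixes L :: "complex mat"
  assumes L: "L \<in> carrier_mat n n" and y: "y \<in> carrier_vec n"
    and M: "\<forall>\<^sub>F t in F. M t \<in> carrier_mat n n"
    and lim: "\<And>i k. i < n \<Longrightarrow> k < n \<Longrightarrow> ((\<lambda>t. M t $$ (i, k)) \<longlongrightarrow> L $$ (i, k)) F"
  shows "((\<lambda>t. tnorm (M t *\<^sub>v y)) \<longlongrightarrow> tnorm (L *\<^sub>v y)) F"
proof -
  have eq: "tnorm (N *\<^sub>v y) = sqrt (\<Sum>i<n. (norm (\<Sum>k<n. N $$ (i, k) * y $\<^sub>v k))\<^sup>2)"
    if "N \<in> carrier_mat n n" for N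
    using that y by (simp add: tnorm_def scalar_prod_def atLeast0LessThan)
  have "((\<lambda>t. sqrt (\<Sum>i<n. (norm (\<Sum>k<n. M t $$ (i, k) * y $\<^sub>v k))\<^sup>2)) \<longlongrightarrow> tnorm (L *\<^sub>v y)) F"
    unfolding eq[OF L] by (auto intro!: tendsto_intros lim)
  moreover have "\<forall>\<^sub>F t in F. sqrt (\<Sum>i<n. (norm (\<Sum>k<n. M t $$ (i, k) * y $\<^sub>v k))\<^sup>2) = tnorm (M t *\<^sub>v y)"
    using M by eventually_elim (simp add: eq)
  ultimately show ?thesis by (rule Lim_transform_eventually)
qed

section \<open>Unitary operators and their blocks\<close>

lemma unitary_op_norm:
  assumes "unitary_op V" shows "norm (V p) = norm p"
proof -
  have "(norm (V p))\<^sup>2 = (norm p)\<^sup>2"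
    using assms unfolding norm_sq_eq_Re_cinner unitary_op_def by simp
  then show ?thesis by simp
qed

lemma unitary_op_diff:
  assumes "unitary_op V" shows "V (p - q) = V p - V q"
  using assms bounded_linear.linear linear_diff unfolding unitary_op_def bounded_clinear_def
  by blast

abbreviation unitary_inverse :: "('a \<Rightarrow> 'b) \<Rightarrow> 'b \<Rightarrow> 'a" where
  "unitary_inverse V \<equiv> inv_into UNIV V"

text \<open>The adjoint of a unitary operator is its inverse.  Adjoints of blocks are compressions of this
  inverse.\<close>

lemma unitary_op_inv:
  assumes V: "unitary_op V"
  shows "V (unitary_inverse V q) = q" and "unitary_inverse V (V p) = p"
    and "cinner (V p) q = cinner p (unitary_inverse V q)"
    and "unitary_op (unitary_inverse V)"
proof -
  have surj: "surj V" and lin: "bounded_linear V" and scale: "V (c *\<^sub>C p) = c *\<^sub>C V p"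
    and pres: "cinner (V p) (V q) = cinner p q" for c p q
    using V by (auto simp: unitary_op_def bounded_clinear_def)
  have inj: "inj V"
  proof (rule injI)
    fix p q assume "V p = V q"
    then have "norm (p - q) = 0"
      using unitary_op_norm[OF V, of "p - q"] by (simp add: unitary_op_diff[OF V])
    then show "p = q" by simp
  qed
  have r: "V (unitary_inverse V q) = q" for q using surj by (rule surj_f_inv_f)
  have l: "unitary_inverse V (V p) = p" for p using inj by (rule inv_f_f)
  show "V (unitary_inverse V q) = q" "unitary_inverse V (V p) = p" by (fact r l)+
  show "cinner (V p) q = cinner p (unitary_inverse V q)" using pres[of p "unitary_inverse V q"] by (simp add: r)
  have norm: "norm (unitary_inverse V q) = norm q" for q using unitary_op_norm[OF V, of "unitary_inverse V q"] by (simp add: r)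
  have add: "unitary_inverse V (p + q) = unitary_inverse V p + unitary_inverse V q" for p q
    by (rule injD[OF inj]) (simp add: r linear_add[OF bounded_linear.linear[OF lin]])
  have scC: "unitary_inverse V (c *\<^sub>C q) = c *\<^sub>C unitary_inverse V q" for c q
    by (rule injD[OF inj]) (simp add: r scale)
  have scR: "unitary_inverse V (t *\<^sub>R q) = t *\<^sub>R unitary_inverse V q" for t q
    using scC[of "complex_of_real t" q] by (simp add: scaleC_of_real)
  have "bounded_linear (unitary_inverse V)"
    by (rule bounded_linear_intro[of _ 1]) (simp_all add: add scR norm)
  moreover have "cinner (unitary_inverse V p) (unitary_inverse V q) = cinner p q" for p q
    using pres[of "unitary_inverse V p" "unitary_inverse V q"] by (simp add: r)
  moreover have "surj (unitary_inverse V)" using inj by (rule inj_imp_surj_inv)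
  ultimately show "unitary_op (unitary_inverse V)" by (simp add: unitary_op_def bounded_clinear_def scC)
qed

lemma norm_Pair_sq: "(norm (a, b))\<^sup>2 = (norm a)\<^sup>2 + (norm b)\<^sup>2"
  by (simp add: norm_Pair)

lemma norm_snd_le_norm: "norm (snd p) \<le> norm p"
  by (metis norm_snd_le prod.collapse)

text \<open>As \<open>C\<close> vanishes at 0, the block \<open>D\<close> is the corner of \<open>V\<close> on the vectors \<open>(0, x)\<close>, and it inherits
  linearity and contractivity from \<open>V\<close>.\<close>

locale unitary_colligation =
  fixes A :: "'u::complex_hilbert \<Rightarrow> 'y::complex_hilbert"
    and B :: "'x::complex_hilbert \<Rightarrow> 'y" and C :: "'u \<Rightarrow> 'p::complex_hilbert" and D :: "'x \<Rightarrow> 'p"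
  assumes unitary: "unitary_op (\<lambda>(u, x). (A u + B x, C u + D x))"
    and C_zero: "C 0 = 0"
begin

definition V where "V = (\<lambda>(u, x). (A u + B x, C u + D x))"

lemma V_unitary: "unitary_op V"
  unfolding V_def by (rule unitary)

lemma V_apply: "V (u, x) = (A u + B x, C u + D x)"
  by (simp add: V_def)

lemma D_eq: "D x = snd (V (0, x))"
  by (simp add: V_apply C_zero)

lemma D_contraction: "norm (D x) \<le> norm x"
  using norm_snd_le_norm[of "V (0, x)"] by (simp add: D_eq unitary_op_norm[OF V_unitary])

lemma D_diff: "D (x - x') = D x - D x'"
proof -
  have "V (0, x - x') = V (0, x) - V (0, x')"
    using unitary_op_diff[OF V_unitary, of "(0, x)" "(0, x')"] by simp
  then show ?thesis by (simp only: D_eq snd_diff)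
qed

lemma cadjoint_D: "cadjoint D p = snd (unitary_inverse V (0, p))"
  unfolding cadjoint_def
proof (rule the_equality)
  have *: "cinner (D v) p = cinner v (snd (unitary_inverse V (0, p)))" for v
    using unitary_op_inv(3)[OF V_unitary, of "(0, v)" "(0, p)"]
    by (simp add: cinner_prod_def V_apply C_zero)
  then show "\<forall>v. cinner (D v) p = cinner v (snd (unitary_inverse V (0, p)))" by blast
  fix u assume "\<forall>v. cinner (D v) p = cinner v u"
  then have "cinner v u = cinner v (snd (unitary_inverse V (0, p)))" for v
    unfolding *[symmetric] by simp
  then show "u = snd (unitary_inverse V (0, p))" by (rule cinner_ext_right)
qed

lemma cadjoint_D_contraction: "norm (cadjoint D p) \<le> norm p"
  using norm_snd_le_norm[of "unitary_inverse V (0, p)"]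
  by (simp add: cadjoint_D unitary_op_norm[OF unitary_op_inv(4)[OF V_unitary]])

lemma cadjoint_D_diff: "cadjoint D (p - p') = cadjoint D p - cadjoint D p'"
  using unitary_op_diff[OF unitary_op_inv(4)[OF V_unitary], of "(0, p)" "(0, p')"]
  by (simp add: cadjoint_D)

lemma cadjoint_D_scaleR: "cadjoint D (c *\<^sub>R p) = c *\<^sub>R cadjoint D p"
proof -
  have "unitary_inverse V (c *\<^sub>R (0, p)) = c *\<^sub>R unitary_inverse V (0, p)"
    using unitary_op_inv(4)[OF V_unitary]
    by (simp add: unitary_op_def bounded_clinear_def bounded_linear.linear linear_scale del: scaleR_Pair)
  then show ?thesis by (simp add: cadjoint_D)
qed

text \<open>This is the adjoint of \<open>B\<close> when \<open>A\<close> is linear.\<close>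

definition B_adj where "B_adj y = snd (unitary_inverse V (y, 0))"

lemma B_adj_contraction: "norm (B_adj y) \<le> norm y"
  using norm_snd_le_norm[of "unitary_inverse V (y, 0)"]
  by (simp add: B_adj_def unitary_op_norm[OF unitary_op_inv(4)[OF V_unitary]])

lemma snd_inv_V: "snd (unitary_inverse V (y, p)) = B_adj y + cadjoint D p"
proof -
  have "unitary_inverse V ((y, 0) - (0, - p)) = unitary_inverse V (y, 0) - unitary_inverse V (0, - p)"
    by (rule unitary_op_diff[OF unitary_op_inv(4)[OF V_unitary]])
  moreover have "unitary_inverse V ((0, 0) - (0, p)) = unitary_inverse V (0, 0) - unitary_inverse V (0, p)"
    by (rule unitary_op_diff[OF unitary_op_inv(4)[OF V_unitary]])
  moreover have "unitary_inverse V (0, 0) = 0"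
    using unitary_op_norm[OF unitary_op_inv(4)[OF V_unitary], of "(0, 0)"] by simp
  ultimately show ?thesis by (simp add: B_adj_def cadjoint_D)
qed

end

section \<open>Resolvents and the two energy identities\<close>

lemma level_inverse_resolvent:
  fixes G :: "'k::complex_hilbert Matrix.vec \<Rightarrow> 'k Matrix.vec"
  assumes G: "\<And>w. w \<in> carrier_vec n \<Longrightarrow> G w \<in> carrier_vec n"
    and lip: "\<And>v w. v \<in> carrier_vec n \<Longrightarrow> w \<in> carrier_vec n \<Longrightarrow>
      tnorm (G v - G w) \<le> t * tnorm (v - w)"
    and t: "t < 1" and v: "v \<in> carrier_vec n"
  shows "level_inverse n (\<lambda>w. w - G w) v \<in> carrier_vec n"
    and "level_inverse n (\<lambda>w. w - G w) v - G (level_inverse n (\<lambda>w. w - G w) v) = v"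
  using theI'[OF ex1_resolvent[OF assms]] unfolding level_inverse_def the_inv_into_def by auto

text \<open>This is applied with \<open>E = D\<close> to the operator at a point, and with \<open>E = D\<^sup>*\<close> to its adjoint.\<close>

lemma lipschitz_comp:
  fixes Z :: "'p::complex_hilbert Matrix.vec \<Rightarrow> 'x::complex_hilbert Matrix.vec"
  assumes Zt: "\<And>v. v \<in> carrier_vec n \<Longrightarrow> Zt v = map_vec ((*\<^sub>R) t) (Z v)"
    and Zc: "\<And>v. v \<in> carrier_vec n \<Longrightarrow> Z v \<in> carrier_vec n"
    and Zdiff: "\<And>v w. v \<in> carrier_vec n \<Longrightarrow> w \<in> carrier_vec n \<Longrightarrow> Z (v - w) = Z v - Z w"
    and Zle: "\<And>v. v \<in> carrier_vec n \<Longrightarrow> tnorm (Z v) \<le> tnorm v"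
    and t: "0 < t"
    and E: "\<And>x. norm (E x) \<le> norm x" "\<And>x y. E (x - y) = E x - E y"
    and v: "v \<in> carrier_vec n" "w \<in> carrier_vec n"
  shows "tnorm (Zt (map_vec E v) - Zt (map_vec E w)) \<le> t * tnorm (v - w)"
proof -
  have "map_vec E (v - w) = map_vec E v - map_vec E w" using v by (auto simp: E(2))
  then have "Z (map_vec E (v - w)) = Z (map_vec E v) - Z (map_vec E w)" using v by (simp add: Zdiff)
  moreover have "Z (map_vec E v) \<in> carrier_vec n" "Z (map_vec E w) \<in> carrier_vec n"
    using v by (auto intro: Zc)
  ultimately have "Zt (map_vec E v) - Zt (map_vec E w) = map_vec ((*\<^sub>R) t) (Z (map_vec E (v - w)))"
    using v by (auto simp: Zt scaleR_diff_right)
  then have "tnorm (Zt (map_vec E v) - Zt (map_vec E w)) = t * tnorm (Z (map_vec E (v - w)))"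
    using t by (simp add: tnorm_scaleR)
  also have "\<dots> \<le> t * tnorm (v - w)"
    using v t Zle[of "map_vec E (v - w)"] tnorm_map_le[of E "v - w"] E(1)
    by (intro mult_left_mono) (auto intro: order_trans)
  finally show ?thesis .
qed

context unitary_colligation
begin

text \<open>For \<open>Z = nc_lin Q X\<close> these are the vectors in the realization formula: the state
  \<open>x = (I - ZD)\<^sup>-\<^sup>1ZCy\<close>, the vector \<open>w = Cy + Dx\<close> that returns to it through \<open>x = Zw\<close>, and the value
  \<open>f(X)y = Ay + Bx\<close>.\<close>

definition state where
  "state n Z y = level_inverse n (\<lambda>w. w - Z (map_vec D w)) (Z (map_vec C y))"

definition feedback where
  "feedback n Z y = map_vec C y + map_vec D (state n Z y)"

definition transfer where
  "transfer n Z y = map_vec A y + map_vec B (state n Z y)"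

text \<open>Below, \<open>Z\<close> is a contraction, such as the operator at a boundary point, and \<open>Zt\<close> agrees with
  \<open>tZ\<close> on the level.\<close>

context
  fixes n :: nat and t :: real
    and Z Zt :: "'p Matrix.vec \<Rightarrow> 'x Matrix.vec"
  assumes Zt: "\<And>v. v \<in> carrier_vec n \<Longrightarrow> Zt v = map_vec ((*\<^sub>R) t) (Z v)"
    and Zc: "\<And>v. v \<in> carrier_vec n \<Longrightarrow> Z v \<in> carrier_vec n"
    and Zdiff: "\<And>v w. v \<in> carrier_vec n \<Longrightarrow> w \<in> carrier_vec n \<Longrightarrow> Z (v - w) = Z v - Z w"
    and Zle: "\<And>v. v \<in> carrier_vec n \<Longrightarrow> tnorm (Z v) \<le> tnorm v"
    and t: "0 < t" "t < 1"
begin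

lemma state_carrier: assumes "y \<in> carrier_vec n" shows "state n Zt y \<in> carrier_vec n"
  unfolding state_def
  using assms lipschitz_comp[OF Zt Zc Zdiff Zle t(1) D_contraction D_diff] t
  by (intro level_inverse_resolvent(1)[where t=t]) (auto simp: Zt Zc)

lemma feedback_carrier: "y \<in> carrier_vec n \<Longrightarrow> feedback n Zt y \<in> carrier_vec n"
  using state_carrier by (simp add: feedback_def)

lemma transfer_carrier: "y \<in> carrier_vec n \<Longrightarrow> transfer n Zt y \<in> carrier_vec n"
  using state_carrier by (simp add: transfer_def)

lemma state_eq:
  assumes y: "y \<in> carrier_vec n" shows "state n Zt y = map_vec ((*\<^sub>R) t) (Z (feedback n Zt y))"
proof -
  note c = state_carrier[OF y] feedback_carrier[OF y]
  have eq: "state n Zt y - Zt (map_vec D (state n Zt y)) = Zt (map_vec C y)"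
    unfolding state_def
    using y lipschitz_comp[OF Zt Zc Zdiff Zle t(1) D_contraction D_diff] t
    by (intro level_inverse_resolvent(2)[where t=t]) (auto simp: Zt Zc)
  have "map_vec C y = feedback n Zt y - map_vec D (state n Zt y)" using y c by (auto simp: feedback_def)
  then have Z: "Z (map_vec C y) = Z (feedback n Zt y) - Z (map_vec D (state n Zt y))"
    using c by (simp add: Zdiff)
  have carr: "Z (feedback n Zt y) \<in> carrier_vec n" "Z (map_vec D (state n Zt y)) \<in> carrier_vec n"
    using c by (auto intro: Zc)
  show ?thesis
  proof (rule Matrix.eq_vecI)
    fix i assume "i < dim_vec (map_vec ((*\<^sub>R) t) (Z (feedback n Zt y)))"
    then have i: "i < n" using carr by simp
    have "(state n Zt y - Zt (map_vec D (state n Zt y))) $\<^sub>v i = Zt (map_vec C y) $\<^sub>v i" by (simp only: eq)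
    then show "state n Zt y $\<^sub>v i = map_vec ((*\<^sub>R) t) (Z (feedback n Zt y)) $\<^sub>v i"
      using i carr c y by (simp add: Zt Z scaleR_diff_right)
  qed (use c carr in simp)
qed

text \<open>The unitary \<open>V\<close> acts in each of the \<open>n\<close> coordinates of a level, so that identities for \<open>V\<close> can be
  summed over the coordinates.\<close>

lemma V_level:
  assumes "y \<in> carrier_vec n" "i < n"
  shows "V (y $\<^sub>v i, state n Zt y $\<^sub>v i) = (transfer n Zt y $\<^sub>v i, feedback n Zt y $\<^sub>v i)"
  using assms state_carrier[OF assms(1)] by (simp add: V_apply transfer_def feedback_def)

text \<open>The norm identity is energy conservation, with \<open>\<parallel>x\<parallel> = t\<parallel>w\<parallel>\<close> for the state \<open>x\<close>.  The estimate comes from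
  \<open>D\<^sup>*w - Zw = (t - 1)Zw - B\<^sup>*f(X)y\<close>, where \<open>\<parallel>B\<^sup>*f(X)y\<parallel> \<le> \<parallel>f(X)y\<parallel> \<le> \<parallel>y\<parallel>\<close>.\<close>

lemma isometric_case:
  assumes iso: "\<And>v. v \<in> carrier_vec n \<Longrightarrow> tnorm (Z v) = tnorm v" and y: "y \<in> carrier_vec n"
  shows "(1 - t\<^sup>2) * (tnorm (feedback n Zt y))\<^sup>2 = (tnorm y)\<^sup>2 - (tnorm (transfer n Zt y))\<^sup>2"
    and "tnorm (map_vec (cadjoint D) (feedback n Zt y) - Z (feedback n Zt y)) \<le> (1 - t) * tnorm (feedback n Zt y) + tnorm y"
proof -
  note c = state_carrier[OF y] feedback_carrier[OF y] transfer_carrier[OF y]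
  have "(norm (transfer n Zt y $\<^sub>v i))\<^sup>2 + (norm (feedback n Zt y $\<^sub>v i))\<^sup>2 = (norm (y $\<^sub>v i))\<^sup>2 + (norm (state n Zt y $\<^sub>v i))\<^sup>2"
    if "i < n" for i
    using arg_cong[OF V_level[OF y that], of "\<lambda>p. (norm p)\<^sup>2"]
    by (simp add: unitary_op_norm[OF V_unitary] norm_Pair_sq)
  then have "(\<Sum>i<n. (norm (transfer n Zt y $\<^sub>v i))\<^sup>2 + (norm (feedback n Zt y $\<^sub>v i))\<^sup>2)
      = (\<Sum>i<n. (norm (y $\<^sub>v i))\<^sup>2 + (norm (state n Zt y $\<^sub>v i))\<^sup>2)" by (intro sum.cong) auto
  then have energy: "(tnorm (transfer n Zt y))\<^sup>2 + (tnorm (feedback n Zt y))\<^sup>2 = (tnorm y)\<^sup>2 + (tnorm (state n Zt y))\<^sup>2"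
    using y c by (simp add: sum.distrib tnorm_sq[of _ n])
  have st: "tnorm (state n Zt y) = t * tnorm (feedback n Zt y)"
    using t c by (simp add: state_eq[OF y] tnorm_scaleR iso)
  show gain: "(1 - t\<^sup>2) * (tnorm (feedback n Zt y))\<^sup>2 = (tnorm y)\<^sup>2 - (tnorm (transfer n Zt y))\<^sup>2"
    using energy by (simp add: st algebra_simps power_mult_distrib)
  have "0 \<le> (1 - t\<^sup>2) * (tnorm (feedback n Zt y))\<^sup>2" using t by (simp add: power_le_one)
  then have "(tnorm (transfer n Zt y))\<^sup>2 \<le> (tnorm y)\<^sup>2" unfolding gain by simp
  then have le: "tnorm (transfer n Zt y) \<le> tnorm y" using tnorm_nonneg by (rule power2_le_imp_le)
  have "map_vec (cadjoint D) (feedback n Zt y) - Z (feedback n Zt y)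
      = map_vec ((*\<^sub>R) (t - 1)) (Z (feedback n Zt y)) - map_vec B_adj (transfer n Zt y)"
  proof (rule Matrix.eq_vecI)
    fix i assume "i < dim_vec (map_vec ((*\<^sub>R) (t - 1)) (Z (feedback n Zt y)) - map_vec B_adj (transfer n Zt y))"
    then have i: "i < n" using c by simp
    have "B_adj (transfer n Zt y $\<^sub>v i) + cadjoint D (feedback n Zt y $\<^sub>v i) = state n Zt y $\<^sub>v i"
      unfolding snd_inv_V[symmetric] V_level[OF y i, symmetric] unitary_op_inv(2)[OF V_unitary]
      by (rule snd_conv)
    also have "\<dots> = t *\<^sub>R Z (feedback n Zt y) $\<^sub>v i" using i Zc[OF c(2)] by (simp add: state_eq[OF y])
    finally have "cadjoint D (feedback n Zt y $\<^sub>v i) = t *\<^sub>R Z (feedback n Zt y) $\<^sub>v i - B_adj (transfer n Zt y $\<^sub>v i)"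
      by (simp add: algebra_simps)
    then show "(map_vec (cadjoint D) (feedback n Zt y) - Z (feedback n Zt y)) $\<^sub>v i
        = (map_vec ((*\<^sub>R) (t - 1)) (Z (feedback n Zt y)) - map_vec B_adj (transfer n Zt y)) $\<^sub>v i"
      using i c Zc[OF c(2)] by (simp add: scaleR_diff_left)
  qed (use c Zc[OF c(2)] in simp)
  also have "tnorm \<dots> \<le> tnorm (map_vec ((*\<^sub>R) (t - 1)) (Z (feedback n Zt y))) + tnorm (map_vec B_adj (transfer n Zt y))"
    using c Zc[OF c(2)] by (intro tnorm_diff_triangle[of _ n]) auto
  also have "\<dots> \<le> (1 - t) * tnorm (feedback n Zt y) + tnorm y"
    using tnorm_map_le[of B_adj "transfer n Zt y", OF B_adj_contraction] le t c
    by (simp add: tnorm_scaleR iso)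
  finally show "tnorm (map_vec (cadjoint D) (feedback n Zt y) - Z (feedback n Zt y)) \<le> (1 - t) * tnorm (feedback n Zt y) + tnorm y" .
qed

text \<open>The vector \<open>g\<close> is \<open>f(X)\<^sup>*y\<close>, and it is described by its inner products.  These are found by pairing
  \<open>V(x, s) = (f(X)x, p)\<close> with \<open>(y, u)\<close>, where \<open>V\<^sup>*(y, u) = (g, m)\<close>: as \<open>s = tZp\<close> and \<open>u = tZ\<^sup>*m\<close>, the terms
  \<open>\<langle>p, u\<rangle>\<close> and \<open>\<langle>s, m\<rangle>\<close> cancel.\<close>

lemma coisometric_case:
  assumes adj: "\<And>v w. v \<in> carrier_vec n \<Longrightarrow> w \<in> carrier_vec n \<Longrightarrow> tinner (Z v) w = tinner v (Zs w)"
    and Zsc: "\<And>w. w \<in> carrier_vec n \<Longrightarrow> Zs w \<in> carrier_vec n"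
    and Zsdiff: "\<And>v w. v \<in> carrier_vec n \<Longrightarrow> w \<in> carrier_vec n \<Longrightarrow> Zs (v - w) = Zs v - Zs w"
    and Zsiso: "\<And>w. w \<in> carrier_vec n \<Longrightarrow> tnorm (Zs w) = tnorm w"
    and ZZs: "\<And>w. w \<in> carrier_vec n \<Longrightarrow> Z (Zs w) = w"
    and Zscale: "\<And>v. Z (map_vec ((*\<^sub>R) t) v) = map_vec ((*\<^sub>R) t) (Z v)"
    and y: "y \<in> carrier_vec n"
  obtains u g where "u \<in> carrier_vec n" "g \<in> carrier_vec n"
    "\<And>x. x \<in> carrier_vec n \<Longrightarrow> tinner (transfer n Zt x) y = tinner x g"
    "(1 - t\<^sup>2) * (tnorm u)\<^sup>2 = t\<^sup>2 * ((tnorm y)\<^sup>2 - (tnorm g)\<^sup>2)"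
    "tnorm (map_vec (cadjoint D) u - Z u) \<le> (1 - t) / t * tnorm u + tnorm y"
proof -
  let ?Zst = "\<lambda>w. map_vec ((*\<^sub>R) t) (Zs w)"
  have Zsle: "tnorm (Zs w) \<le> tnorm w" if "w \<in> carrier_vec n" for w using Zsiso[OF that] by simp
  have lip: "tnorm (?Zst (map_vec (cadjoint D) v) - ?Zst (map_vec (cadjoint D) w)) \<le> t * tnorm (v - w)"
    if "v \<in> carrier_vec n" "w \<in> carrier_vec n" for v w
    by (rule lipschitz_comp[where Z=Zs and E="cadjoint D" and Zt="?Zst" and n=n])
      (use Zsc Zsdiff Zsle t cadjoint_D_contraction cadjoint_D_diff that in auto)
  have "\<exists>!u. u \<in> carrier_vec n \<and> u - ?Zst (map_vec (cadjoint D) u) = ?Zst (map_vec B_adj y)"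
    by (rule ex1_resolvent[OF _ lip t(2)]) (use Zsc y in auto)
  then obtain u where u: "u \<in> carrier_vec n"
    and ueq: "u - ?Zst (map_vec (cadjoint D) u) = ?Zst (map_vec B_adj y)" by blast
  define m where "m = map_vec B_adj y + map_vec (cadjoint D) u"
  define g where "g = Matrix.vec n (\<lambda>i. fst (unitary_inverse V (y $\<^sub>v i, u $\<^sub>v i)))"
  have m: "m \<in> carrier_vec n" and g: "g \<in> carrier_vec n" using y u by (auto simp: m_def g_def)
  have Zsm: "Zs m \<in> carrier_vec n" using m by (rule Zsc)
  have inv: "unitary_inverse V (y $\<^sub>v i, u $\<^sub>v i) = (g $\<^sub>v i, m $\<^sub>v i)" if "i < n" for i
    using that y u snd_inv_V[of "y $\<^sub>v i" "u $\<^sub>v i"] by (simp add: g_def m_def prod_eq_iff)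
  have u_eq: "u = ?Zst m"
  proof -
    have "map_vec B_adj y = m - map_vec (cadjoint D) u" using y u by (auto simp: m_def)
    then have Z: "Zs (map_vec B_adj y) = Zs m - Zs (map_vec (cadjoint D) u)"
      using m u by (simp add: Zsdiff)
    have carr: "Zs (map_vec (cadjoint D) u) \<in> carrier_vec n" using u by (auto intro: Zsc)
    show ?thesis
    proof (rule Matrix.eq_vecI)
      fix i assume "i < dim_vec (?Zst m)"
      then have i: "i < n" using Zsm by simp
      have "(u - ?Zst (map_vec (cadjoint D) u)) $\<^sub>v i = ?Zst (map_vec B_adj y) $\<^sub>v i" by (simp only: ueq)
      then show "u $\<^sub>v i = ?Zst m $\<^sub>v i"
        using i carr Zsm u by (simp add: Z scaleR_diff_right)
    qed (use u Zsm in simp)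
  qed
  have un: "tnorm u = t * tnorm m" using t m by (simp add: u_eq tnorm_scaleR Zsiso)
  have "(norm (g $\<^sub>v i))\<^sup>2 + (norm (m $\<^sub>v i))\<^sup>2 = (norm (y $\<^sub>v i))\<^sup>2 + (norm (u $\<^sub>v i))\<^sup>2"
    if "i < n" for i
    using arg_cong[OF inv[OF that], of "\<lambda>p. (norm p)\<^sup>2"]
    by (simp add: unitary_op_norm[OF unitary_op_inv(4)[OF V_unitary]] norm_Pair_sq)
  then have "(\<Sum>i<n. (norm (g $\<^sub>v i))\<^sup>2 + (norm (m $\<^sub>v i))\<^sup>2)
      = (\<Sum>i<n. (norm (y $\<^sub>v i))\<^sup>2 + (norm (u $\<^sub>v i))\<^sup>2)" by (intro sum.cong) auto
  then have energy: "(tnorm g)\<^sup>2 + (tnorm m)\<^sup>2 = (tnorm y)\<^sup>2 + (tnorm u)\<^sup>2"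
    using y u m g by (simp add: sum.distrib tnorm_sq[of _ n])
  have gain: "(1 - t\<^sup>2) * (tnorm u)\<^sup>2 = t\<^sup>2 * ((tnorm y)\<^sup>2 - (tnorm g)\<^sup>2)"
  proof -
    have "(tnorm y)\<^sup>2 - (tnorm g)\<^sup>2 = (1 - t\<^sup>2) * (tnorm m)\<^sup>2"
      using energy by (simp add: un algebra_simps power_mult_distrib)
    then show ?thesis by (simp add: un power_mult_distrib)
  qed
  have duality: "tinner (transfer n Zt x) y = tinner x g" if x: "x \<in> carrier_vec n" for x
  proof -
    note c = state_carrier[OF x] feedback_carrier[OF x] transfer_carrier[OF x]
    have "cinner (transfer n Zt x $\<^sub>v i) (y $\<^sub>v i) + cinner (feedback n Zt x $\<^sub>v i) (u $\<^sub>v i)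
        = cinner (x $\<^sub>v i) (g $\<^sub>v i) + cinner (state n Zt x $\<^sub>v i) (m $\<^sub>v i)" if "i < n" for i
      using unitary_op_inv(3)[OF V_unitary, of "(x $\<^sub>v i, state n Zt x $\<^sub>v i)" "(y $\<^sub>v i, u $\<^sub>v i)"]
      by (simp add: V_level[OF x that] inv[OF that] cinner_prod_def)
    then have "(\<Sum>i<n. cinner (transfer n Zt x $\<^sub>v i) (y $\<^sub>v i) + cinner (feedback n Zt x $\<^sub>v i) (u $\<^sub>v i))
        = (\<Sum>i<n. cinner (x $\<^sub>v i) (g $\<^sub>v i) + cinner (state n Zt x $\<^sub>v i) (m $\<^sub>v i))"
      by (intro sum.cong) auto
    then have *: "tinner (transfer n Zt x) y + tinner (feedback n Zt x) u = tinner x g + tinner (state n Zt x) m"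
      using x c by (simp add: tinner_def sum.distrib)
    have sc: "cinner (t *\<^sub>R a) b = t * cinner a b" for a b :: "'w::complex_hilbert"
      using cinner_scaleC_left[of "complex_of_real t" a b] by (simp add: scaleC_of_real)
    have sc': "cinner a (t *\<^sub>R b) = t * cinner a b" for a b :: "'w::complex_hilbert"
      using cinner_scaleC_right[of a "complex_of_real t" b] by (simp add: scaleC_of_real)
    have "tinner (feedback n Zt x) u = t * tinner (feedback n Zt x) (Zs m)"
      using c Zsm by (simp add: u_eq tinner_def sc' sum_distrib_left)
    also have "\<dots> = t * tinner (Z (feedback n Zt x)) m" using adj[OF c(2) m] by simp
    also have "\<dots> = tinner (state n Zt x) m"
      using Zc[OF c(2)] by (simp add: state_eq[OF x] tinner_def sc sum_distrib_left)
    finally show ?thesis using * by simp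
  qed
  have "Z u = map_vec ((*\<^sub>R) t) m" using m by (simp add: u_eq Zscale ZZs)
  then have "map_vec (cadjoint D) u - Z u = map_vec ((*\<^sub>R) (1 - t)) m - map_vec B_adj y"
    using u m y by (auto simp: m_def scaleR_diff_left)
  then have "tnorm (map_vec (cadjoint D) u - Z u)
      \<le> tnorm (map_vec ((*\<^sub>R) (1 - t)) m) + tnorm (map_vec B_adj y)"
    using m y tnorm_diff_triangle[of "map_vec ((*\<^sub>R) (1 - t)) m" n "map_vec B_adj y"] by simp
  also have "\<dots> \<le> (1 - t) / t * tnorm u + tnorm y"
    using tnorm_map_le[of B_adj y, OF B_adj_contraction] t by (simp add: tnorm_scaleR un)
  finally show thesis using that[OF u g duality gain] by blast
qed

end

end

section \<open>Approximate eigenvectors\<close>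

text \<open>The first bound forces \<open>\<parallel>w\<parallel>\<close> to infinity as \<open>t \<rightarrow> 1\<close>, and then the second one becomes small after
  normalization.  The factors \<open>t\<^sup>2\<close> and \<open>1 / t\<close> let both boundary cases fit the same bounds.\<close>

lemma approx_spectrum_of_blowup:
  fixes T :: "'h::complex_hilbert ^ 'r \<Rightarrow> 'h ^ 's" and Q :: "'d::finite \<Rightarrow> complex ^ 'r ^ 's"
  assumes n: "n > 0" and \<Lambda>: "\<Lambda> \<in> nc_level n"
    and T: "\<And>c x. T (c *\<^sub>R x) = c *\<^sub>R T x" and K: "K \<ge> 0"
    and ex: "\<And>t. 0 < t \<Longrightarrow> t < 1 \<Longrightarrow> \<exists>w\<in>carrier_vec n. t\<^sup>2 * \<delta> t \<le> (1 - t\<^sup>2) * (tnorm w)\<^sup>2 \<and>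
      tnorm (map_vec T w - nc_lin Q \<Lambda> w) \<le> (1 - t) / t * tnorm w + K"
    and \<delta>: "(\<delta> \<longlongrightarrow> d) (at_left 1)" "d > 0"
  shows "\<Lambda> \<in> approx_spectrum Q T"
proof -
  have "\<exists>v\<in>carrier_vec n. tnorm v = 1 \<and> tnorm (map_vec T v - nc_lin Q \<Lambda> v) < \<epsilon>" if "\<epsilon> > 0" for \<epsilon>
  proof -
    \<comment> \<open>a bound for the normalized defect, since the first estimate bounds the inverse of \<open>tnorm w\<close>\<close>
    let ?e = "\<lambda>t::real. (1 - t) / t + K * sqrt ((1 - t\<^sup>2) / (t\<^sup>2 * \<delta> t))"
    have "(?e \<longlongrightarrow> (1 - 1) / 1 + K * sqrt ((1 - 1\<^sup>2) / (1\<^sup>2 * d))) (at_left 1)"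
      using \<delta> by (intro tendsto_intros) auto
    then have "(?e \<longlongrightarrow> 0) (at_left 1)" by simp
    then have "\<forall>\<^sub>F t in at_left 1. ?e t < \<epsilon>" using that by (rule order_tendstoD)
    moreover have "\<forall>\<^sub>F t in at_left 1. \<delta> t > 0" using \<delta> by (rule order_tendstoD)
    moreover have "\<forall>\<^sub>F t::real in at_left 1. 0 < t \<and> t < 1"
      using eventually_at_left_real[of 0 1] by simp
    ultimately have "\<forall>\<^sub>F t in at_left 1. ?e t < \<epsilon> \<and> \<delta> t > 0 \<and> 0 < t \<and> t < 1"
      by eventually_elim simp
    then obtain t where t: "?e t < \<epsilon>" "\<delta> t > 0" "0 < t" "t < 1"
      using eventually_happens'[of "at_left (1::real)"] by auto
    obtain w where w: "w \<in> carrier_vec n" and big: "t\<^sup>2 * \<delta> t \<le> (1 - t\<^sup>2) * (tnorm w)\<^sup>2"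
      and close: "tnorm (map_vec T w - nc_lin Q \<Lambda> w) \<le> (1 - t) / t * tnorm w + K"
      using ex[OF t(3,4)] by blast
    have t2: "0 < t\<^sup>2 * \<delta> t" using t by simp
    have "tnorm w \<noteq> 0" using big t2 by auto
    then have pos: "tnorm w > 0" using tnorm_nonneg[of w] by linarith
    have "1 / tnorm w = sqrt (1 / (tnorm w)\<^sup>2)" using pos by (simp add: real_sqrt_divide)
    also have "\<dots> \<le> sqrt ((1 - t\<^sup>2) / (t\<^sup>2 * \<delta> t))"
      using big t2 pos by (simp add: field_simps)
    finally have inv: "1 / tnorm w \<le> sqrt ((1 - t\<^sup>2) / (t\<^sup>2 * \<delta> t))" .
    define v where "v = map_vec ((*\<^sub>R) (1 / tnorm w)) w"
    have v: "v \<in> carrier_vec n" "tnorm v = 1" using w pos by (auto simp: v_def tnorm_scaleR)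
    have "map_vec T v - nc_lin Q \<Lambda> v = map_vec ((*\<^sub>R) (1 / tnorm w)) (map_vec T w - nc_lin Q \<Lambda> w)"
      unfolding v_def nc_lin_scaleR
      by (rule Matrix.eq_vecI) (simp_all add: T scaleR_diff_right)
    then have "tnorm (map_vec T v - nc_lin Q \<Lambda> v) = tnorm (map_vec T w - nc_lin Q \<Lambda> w) / tnorm w"
      using pos by (simp add: tnorm_scaleR)
    also have "\<dots> \<le> ((1 - t) / t * tnorm w + K) / tnorm w"
      using close pos by (intro divide_right_mono) auto
    also have "\<dots> = (1 - t) / t + K * (1 / tnorm w)" using pos by (simp add: add_divide_distrib)
    also have "\<dots> \<le> ?e t" using mult_left_mono[OF inv K] by simp
    also have "\<dots> < \<epsilon>" by (fact t)
    finally show ?thesis using v by blast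
  qed
  then have "\<exists>v\<in>carrier_vec n. tnorm v = 1 \<and> tnorm (map_vec T v - nc_lin Q \<Lambda> v) < 1 / Suc k" for k
    by simp
  then obtain v where v: "\<And>k. v k \<in> carrier_vec n" "\<And>k. tnorm (v k) = 1"
    "\<And>k. tnorm (map_vec T (v k) - nc_lin Q \<Lambda> (v k)) < 1 / Suc k" by metis
  have "(\<lambda>k. tnorm (map_vec T (v k) - nc_lin Q \<Lambda> (v k))) \<longlonglongrightarrow> 0"
  proof (rule Lim_null_comparison[OF _ lim_1_over_n[THEN LIMSEQ_Suc]])
    show "\<forall>\<^sub>F k in sequentially. norm (tnorm (map_vec T (v k) - nc_lin Q \<Lambda> (v k))) \<le> 1 / real (Suc k)"
      using v(3) by (intro always_eventually) (auto intro: less_imp_le)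
  qed
  then show ?thesis using n \<Lambda> v unfolding approx_spectrum_def by blast
qed

section \<open>Boundary points of a realized function\<close>

lemma realization_colligation:
  assumes "unitary_realization Q f A B C D"
  shows "unitary_colligation A B C D"
proof
  show "unitary_op (\<lambda>(u, x). (A u + B x, C u + D x))"
    using assms by (simp add: unitary_realization_def)
  have "bounded_linear C" using assms by (simp add: unitary_realization_def bounded_clinear_def)
  then show "C 0 = 0" by (rule linear_0[OF bounded_linear.linear])
qed

lemma realization_transfer:
  assumes real: "unitary_realization Q f A B C D"
    and X: "X \<in> nc_ball Q" "X \<in> nc_level n" and u: "u \<in> carrier_vec n"
  shows "f X *\<^sub>v u = unitary_colligation.transfer A B C D n (nc_lin Q X) u"
  using assms unfolding unitary_colligation.transfer_def[OF realization_colligation[OF real]]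
    unitary_colligation.state_def[OF realization_colligation[OF real]] unitary_realization_def
  by blast

lemma BP1_iso_subset_approx_spectrum:
  fixes Q :: "'d::finite \<Rightarrow> complex ^ 'r::finite ^ 's::finite"
    and D :: "'h::complex_hilbert ^ 's \<Rightarrow> 'h ^ 'r"
  assumes f: "nc_function Q f" and real: "unitary_realization Q f A B C D"
  shows "BP1 Q f \<inter> iso_boundary Q \<subseteq> approx_spectrum Q (cadjoint D)"
proof
  fix \<Lambda> assume "\<Lambda> \<in> BP1 Q f \<inter> iso_boundary Q"
  then have BP: "\<Lambda> \<in> BP1 Q f" and iso: "\<Lambda> \<in> iso_boundary Q" by auto
  interpret unitary_colligation A B C D using real by (rule realization_colligation)
  obtain n where n: "n > 0" and \<Lambda>: "\<Lambda> \<in> nc_level n" using iso by (auto simp: iso_boundary_def)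
  obtain L n' y where L: "has_boundary_value f \<Lambda> L" and n': "\<Lambda> \<in> nc_level n'"
    and y': "y \<in> carrier_vec n'" and less: "tnorm (boundary_value f \<Lambda> *\<^sub>v y) < tnorm y"
    using BP unfolding BP1_def BP_def by blast
  have y: "y \<in> carrier_vec n" using y' nc_level_unique[OF n' \<Lambda>] by simp
  define X where "X t = (\<lambda>j. complex_of_real t \<cdot>\<^sub>m \<Lambda> j)" for t
  have Xl: "X t \<in> nc_level n" for t using \<Lambda> by (simp add: X_def nc_level_def)
  have Xb: "X t \<in> nc_ball Q" if "0 < t" "t < 1" for t
    unfolding X_def using that n \<Lambda> by (intro scaled_point_in_ball[of _ n]) (auto simp: tnorm_nc_lin_iso[OF iso])
  have fX: "f (X t) \<in> carrier_mat n n" if "0 < t" "t < 1" for t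
    using f Xl Xb[OF that] by (simp add: nc_function_def)
  note entry = has_boundary_value_entry[OF L \<Lambda> fX[unfolded X_def]]
  have bv: "boundary_value f \<Lambda> = L" by (rule boundary_value_eqI[OF L \<Lambda> fX[unfolded X_def]])
  have near1: "\<forall>\<^sub>F t in at_left 1. 0 < t \<and> t < (1::real)"
    using eventually_at_left_real[of 0 1] by simp
  have lim: "((\<lambda>t. tnorm (f (X t) *\<^sub>v y)) \<longlongrightarrow> tnorm (L *\<^sub>v y)) (at_left 1)"
    using near1 by (intro tendsto_tnorm_mult[OF entry(1) y])
      (auto simp: fX X_def[symmetric] elim!: eventually_mono intro: entry(2)[folded X_def])
  show "\<Lambda> \<in> approx_spectrum Q (cadjoint D)"
  proof (rule approx_spectrum_of_blowup[OF n \<Lambda> cadjoint_D_scaleR tnorm_nonneg])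
    show "((\<lambda>t. (tnorm y)\<^sup>2 - (tnorm (f (X t) *\<^sub>v y))\<^sup>2) \<longlongrightarrow> (tnorm y)\<^sup>2 - (tnorm (L *\<^sub>v y))\<^sup>2) (at_left 1)"
      by (intro tendsto_intros lim)
    show "0 < (tnorm y)\<^sup>2 - (tnorm (L *\<^sub>v y))\<^sup>2"
      using less tnorm_nonneg[of "L *\<^sub>v y"] by (simp add: bv power_strict_mono)
    fix t :: real assume t: "0 < t" "t < 1"
    let ?Z = "nc_lin Q \<Lambda> :: ('h ^ 'r) Matrix.vec \<Rightarrow> ('h ^ 's) Matrix.vec"
    let ?w = "feedback n (nc_lin Q (X t)) y"
    have Zt: "nc_lin Q (X t) v = map_vec ((*\<^sub>R) t) (?Z v)" if "v \<in> carrier_vec n" for v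
      unfolding X_def by (rule nc_lin_scale_point[OF \<Lambda> that])
    have Ziso: "tnorm (?Z v) = tnorm v" if "v \<in> carrier_vec n" for v
      by (rule tnorm_nc_lin_iso[OF iso \<Lambda> that])
    then have Zle: "tnorm (?Z v) \<le> tnorm v" if "v \<in> carrier_vec n" for v using that by simp
    have tr: "transfer n (nc_lin Q (X t)) y = f (X t) *\<^sub>v y"
      using realization_transfer[OF real Xb[OF t] Xl y] by simp
    have w: "?w \<in> carrier_vec n"
      by (rule feedback_carrier[OF Zt nc_lin_carrier nc_lin_diff Zle t y])
    have gain: "(1 - t\<^sup>2) * (tnorm ?w)\<^sup>2 = (tnorm y)\<^sup>2 - (tnorm (f (X t) *\<^sub>v y))\<^sup>2"
      using isometric_case(1)[OF Zt nc_lin_carrier nc_lin_diff Zle t Ziso y] unfolding tr .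
    have close: "tnorm (map_vec (cadjoint D) ?w - ?Z ?w) \<le> (1 - t) * tnorm ?w + tnorm y"
      by (rule isometric_case(2)[OF Zt nc_lin_carrier nc_lin_diff Zle t Ziso y])
    have "t\<^sup>2 * ((1 - t\<^sup>2) * (tnorm ?w)\<^sup>2) \<le> 1 * ((1 - t\<^sup>2) * (tnorm ?w)\<^sup>2)"
      using t by (intro mult_right_mono) (auto simp: power_le_one)
    moreover have "(1 - t) * tnorm ?w \<le> (1 - t) / t * tnorm ?w"
      using t by (intro mult_right_mono) (auto simp: le_divide_eq mult_left_le)
    ultimately show "\<exists>w\<in>carrier_vec n.
        t\<^sup>2 * ((tnorm y)\<^sup>2 - (tnorm (f (X t) *\<^sub>v y))\<^sup>2) \<le> (1 - t\<^sup>2) * (tnorm w)\<^sup>2 \<and>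
        tnorm (map_vec (cadjoint D) w - nc_lin Q \<Lambda> w) \<le> (1 - t) / t * tnorm w + tnorm y"
      using w gain close by (intro bexI[of _ ?w]) auto
  qed
qed

lemma BP1_star_coiso_subset_approx_spectrum:
  fixes Q :: "'d::finite \<Rightarrow> complex ^ 'r::finite ^ 's::finite"
    and D :: "'h::complex_hilbert ^ 's \<Rightarrow> 'h ^ 'r"
  assumes f: "nc_function Q f" and real: "unitary_realization Q f A B C D"
  shows "BP1_star Q f \<inter> coiso_boundary Q \<subseteq> approx_spectrum Q (cadjoint D)"
proof
  fix \<Lambda> assume "\<Lambda> \<in> BP1_star Q f \<inter> coiso_boundary Q"
  then have BP: "\<Lambda> \<in> BP1_star Q f" and coiso: "\<Lambda> \<in> coiso_boundary Q" by auto
  interpret unitary_colligation A B C D using real by (rule realization_colligation)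
  obtain n where n: "n > 0" and \<Lambda>: "\<Lambda> \<in> nc_level n" using coiso by (auto simp: coiso_boundary_def)
  obtain L n' y where L: "has_boundary_value f \<Lambda> L" and n': "\<Lambda> \<in> nc_level n'"
    and y': "y \<in> carrier_vec n'"
    and less': "mat_norm (row_star y * boundary_value f \<Lambda>) < mat_norm (row_star y)"
    using BP unfolding BP1_star_def BP_def by blast
  have y: "y \<in> carrier_vec n" using y' nc_level_unique[OF n' \<Lambda>] by simp
  define X where "X t = (\<lambda>j. complex_of_real t \<cdot>\<^sub>m \<Lambda> j)" for t
  have Xl: "X t \<in> nc_level n" for t using \<Lambda> by (simp add: X_def nc_level_def)
  have Xb: "X t \<in> nc_ball Q" if "0 < t" "t < 1" for t
    unfolding X_def using that n \<Lambda>
    by (intro scaled_point_in_ball[of _ n]) (auto simp: tnorm_nc_lin_coiso_le[OF coiso])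
  have fX: "f (X t) \<in> carrier_mat n n" if "0 < t" "t < 1" for t
    using f Xl Xb[OF that] by (simp add: nc_function_def)
  note entry = has_boundary_value_entry[OF L \<Lambda> fX[unfolded X_def]]
  have bv: "boundary_value f \<Lambda> = L" by (rule boundary_value_eqI[OF L \<Lambda> fX[unfolded X_def]])
  have near1: "\<forall>\<^sub>F t in at_left 1. 0 < t \<and> t < (1::real)"
    using eventually_at_left_real[of 0 1] by simp
  have less: "tnorm (mat_star L *\<^sub>v y) < tnorm y"
    using less' entry(1) y mult_mat_vec_carrier[OF mat_star_carrier[OF entry(1)] y]
    mult_mat_vec_carrier[OF mat_star_carrier[OF entry(1)] y]
    by (simp add: bv row_star_mult[of _ n] mat_norm_row_star[of _ n])
  have lim: "((\<lambda>t. tnorm (mat_star (f (X t)) *\<^sub>v y)) \<longlongrightarrow> tnorm (mat_star L *\<^sub>v y)) (at_left 1)"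
  proof (rule tendsto_tnorm_mult[OF mat_star_carrier[OF entry(1)] y])
    show "\<forall>\<^sub>F t in at_left 1. mat_star (f (X t)) \<in> carrier_mat n n"
      using near1 by eventually_elim (simp add: fX)
    fix i k assume ik: "i < n" "k < n"
    have "((\<lambda>t. cnj (f (X t) $$ (k, i))) \<longlongrightarrow> mat_star L $$ (i, k)) (at_left 1)"
      using tendsto_cnj[OF entry(2)[OF _ _ ik(2,1)], folded X_def]
      by (simp add: mat_star_index[OF entry(1) ik])
    moreover have "\<forall>\<^sub>F t in at_left 1. cnj (f (X t) $$ (k, i)) = mat_star (f (X t)) $$ (i, k)"
      using near1 by eventually_elim (simp add: mat_star_index[OF fX ik])
    ultimately show "((\<lambda>t. mat_star (f (X t)) $$ (i, k)) \<longlongrightarrow> mat_star L $$ (i, k)) (at_left 1)"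
      by (rule Lim_transform_eventually)
  qed
  show "\<Lambda> \<in> approx_spectrum Q (cadjoint D)"
  proof (rule approx_spectrum_of_blowup[OF n \<Lambda> cadjoint_D_scaleR tnorm_nonneg])
    show "((\<lambda>t. (tnorm y)\<^sup>2 - (tnorm (mat_star (f (X t)) *\<^sub>v y))\<^sup>2)
        \<longlongrightarrow> (tnorm y)\<^sup>2 - (tnorm (mat_star L *\<^sub>v y))\<^sup>2) (at_left 1)"
      by (intro tendsto_intros lim)
    show "0 < (tnorm y)\<^sup>2 - (tnorm (mat_star L *\<^sub>v y))\<^sup>2"
      using less tnorm_nonneg[of "mat_star L *\<^sub>v y"] by (simp add: power_strict_mono)
    fix t :: real assume t: "0 < t" "t < 1"
    let ?Z = "nc_lin Q \<Lambda> :: ('h ^ 'r) Matrix.vec \<Rightarrow> ('h ^ 's) Matrix.vec"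
    have Zt: "nc_lin Q (X t) v = map_vec ((*\<^sub>R) t) (?Z v)" if "v \<in> carrier_vec n" for v
      unfolding X_def by (rule nc_lin_scale_point[OF \<Lambda> that])
    have Zle: "tnorm (?Z v) \<le> tnorm v" if "v \<in> carrier_vec n" for v
      by (rule tnorm_nc_lin_coiso_le[OF coiso \<Lambda> that])
    obtain u g where u: "u \<in> carrier_vec n" and g: "g \<in> carrier_vec n"
      and dual: "\<And>x. x \<in> carrier_vec n \<Longrightarrow> tinner (transfer n (nc_lin Q (X t)) x) y = tinner x g"
      and gain: "(1 - t\<^sup>2) * (tnorm u)\<^sup>2 = t\<^sup>2 * ((tnorm y)\<^sup>2 - (tnorm g)\<^sup>2)"
      and close: "tnorm (map_vec (cadjoint D) u - ?Z u) \<le> (1 - t) / t * tnorm u + tnorm y"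
      by (rule coisometric_case[OF Zt nc_lin_carrier nc_lin_diff Zle t
            tinner_nc_lin[OF \<Lambda>] nc_lin_carrier nc_lin_diff tnorm_nc_lin_star_coiso[OF coiso \<Lambda>]
            coiso_boundary_mult_star[OF coiso \<Lambda>] nc_lin_scaleR y]) blast+
    have "mat_star (f (X t)) *\<^sub>v y = g"
    proof (rule tinner_ext_right)
      fix x :: "complex Matrix.vec" assume x: "x \<in> carrier_vec n"
      have "tinner x (mat_star (f (X t)) *\<^sub>v y) = tinner (f (X t) *\<^sub>v x) y"
        using tinner_mult_mat_vec[OF fX[OF t] x y] by simp
      also have "\<dots> = tinner x g"
        using dual[OF x] realization_transfer[OF real Xb[OF t] Xl x] by simp
      finally show "tinner x (mat_star (f (X t)) *\<^sub>v y) = tinner x g" .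
    qed (use mult_mat_vec_carrier[OF mat_star_carrier[OF fX[OF t]] y] g in simp_all)
    then show "\<exists>w\<in>carrier_vec n.
        t\<^sup>2 * ((tnorm y)\<^sup>2 - (tnorm (mat_star (f (X t)) *\<^sub>v y))\<^sup>2) \<le> (1 - t\<^sup>2) * (tnorm w)\<^sup>2 \<and>
        tnorm (map_vec (cadjoint D) w - nc_lin Q \<Lambda> w) \<le> (1 - t) / t * tnorm w + tnorm y"
      using u gain close by (intro bexI[of _ u]) auto
  qed
qed

theorem theorem5:
  fixes Q :: "'d::finite \<Rightarrow> complex ^ 'r::finite ^ 's::finite"
    and f :: "('d \<Rightarrow> complex mat) \<Rightarrow> complex mat"
    and A :: "complex \<Rightarrow> complex"
    and B :: "'h::complex_hilbert ^ 's \<Rightarrow> complex"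
    and C :: "complex \<Rightarrow> 'h ^ 'r"
    and D :: "'h ^ 's \<Rightarrow> 'h ^ 'r"
  assumes "clin_indep_family Q"
    and "f \<in> schur_agler Q"
    and "\<not> nc_constant Q f"
    and "unitary_realization Q f A B C D"
  shows "(BP1 Q f \<inter> iso_boundary Q) \<union> (BP1_star Q f \<inter> coiso_boundary Q)
    \<subseteq> approx_spectrum Q (cadjoint D)"
proof -
  have "nc_function Q f" using assms(2) by (simp add: schur_agler_def)
  then show ?thesis
    using BP1_iso_subset_approx_spectrum[OF _ assms(4)]
      BP1_star_coiso_subset_approx_spectrum[OF _ assms(4)] by (intro Un_least)
qed

end
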